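(* Let $T$ be a complete affine theory and $M\vDash T$. Let $A\subseteq B\subseteq M$, and let $a,b\in M^x$ be such that $a\equiv^{\mathrm{aff}}_Ab$. Then there exist an affine extension $N\succeq^{\mathrm{aff}}M$ and a subset $B'\subseteq N$ such that $B'\equiv^{\mathrm{aff}}_AB$ (relative to some common enumeration) and $a\equiv^{\mathrm{aff}}_{B'}b$. In particular, $A\subseteq B'$.
   Context: Languages $\mathcal L$ and structures are those of continuous (metric) first-order logic: languages may be many-sorted; each sort of a structure is a non-empty bounded complete metric space with distance symbol $d$; predicate symbols are bounded and real-valued; bounds and (concave) moduli of uniform continuity of all symbols are prescribed by $\mathcal L$. Affine formulas are built from atomic formulas (including $d(t,t')$) using only affine connectives (real constants, sums, multiplication by real scalars) and the quantifiers $\sup$, $\inf$. An affine theory is a set of conditions $\sigma\ge0$, $\sigma$ an affine sentence; it is complete if it is consistent and determines the value of every affine sentence. $M\preceq^{\mathrm{aff}}N$ ($N$ is an affine extension of $M$) means that $M$ is a substructure of $N$ and $\psi^M(a)=\psi^N(a)$ for every affine formula $\psi$ and tuple $a$ in $M$. For tuples $a,b$, $a\equiv^{\mathrm{aff}}_Ab$ means that $\psi(a,c)=\psi(b,c)$ for every affine formula $\psi$ and tuple $c$ in $A$; for sets, $B'\equiv^{\mathrm{aff}}_AB$ means this for corresponding enumerations of $B'$ and $B$. *)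

theory Defs
  imports "HOL-Analysis.Analysis"
begin

section \<open>Languages\<close>

text \<open>The sorts are all the elements of \<open>'s\<close>; the function symbols (constants being those of
  arity \<open>[]\<close>) and predicate symbols are given by subsets of \<open>'f\<close> and \<open>'p\<close>, so that either kind
  may be absent. The modulus of a symbol of arity \<open>n\<close> is a function on \<open>[0,\<infinity>)\<^sup>n\<close>, represented
  by lists of length \<open>n\<close>. This covers moduli with respect to the sum distance on tuples
  (\<open>\<lambda>t. \<Delta> (sum_list t)\<close>) as well as sums of argumentwise moduli.\<close>

record ('s, 'f, 'p) lang =
  diam_bound :: "'s \<Rightarrow> real"
  funs :: "'f set"
  fdom :: "'f \<Rightarrow> 's list"
  fcod :: "'f \<Rightarrow> 's"
  fmodulus :: "'f \<Rightarrow> real list \<Rightarrow> real"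
  preds :: "'p set"
  pdom :: "'p \<Rightarrow> 's list"
  plower :: "'p \<Rightarrow> real"
  pupper :: "'p \<Rightarrow> real"
  pmodulus :: "'p \<Rightarrow> real list \<Rightarrow> real"

definition orthant :: "nat \<Rightarrow> real list set" where
  "orthant n = {t. length t = n \<and> (\<forall>x\<in>set t. 0 \<le> x)}"

definition concave_modulus :: "nat \<Rightarrow> (real list \<Rightarrow> real) \<Rightarrow> bool" where
  "concave_modulus n \<Delta> \<longleftrightarrow>
     \<Delta> (replicate n 0) = 0 \<and>
     (\<forall>\<epsilon>>0. \<exists>\<delta>>0. \<forall>t\<in>orthant n. (\<forall>x\<in>set t. x < \<delta>) \<longrightarrow> \<Delta> t < \<epsilon>) \<and>
     (\<forall>t\<in>orthant n. \<forall>u\<in>orthant n. list_all2 (\<le>) t u \<longrightarrow> \<Delta> t \<le> \<Delta> u) \<and>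
     (\<forall>t\<in>orthant n. \<forall>u\<in>orthant n. \<Delta> (map2 (+) t u) \<le> \<Delta> t + \<Delta> u) \<and>
     (\<forall>t\<in>orthant n. \<forall>u\<in>orthant n. \<forall>r\<in>{0..1}.
        (1 - r) * \<Delta> t + r * \<Delta> u \<le> \<Delta> (map2 (\<lambda>x y. (1 - r) * x + r * y) t u))"

definition language :: "('s, 'f, 'p) lang \<Rightarrow> bool" where
  "language L \<longleftrightarrow>
     (\<forall>f\<in>funs L. concave_modulus (length (fdom L f)) (fmodulus L f)) \<and>
     (\<forall>p\<in>preds L. concave_modulus (length (pdom L p)) (pmodulus L p))"

section \<open>Structures\<close>

text \<open>The sorts of a structure are subsets of one ambient type. They need not be disjoint, hence
  a subset of a structure is a family of sets indexed by the sorts.\<close>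

record ('s, 'f, 'p, 'a) struct =
  carrier :: "'s \<Rightarrow> 'a set"
  mdist :: "'s \<Rightarrow> 'a \<Rightarrow> 'a \<Rightarrow> real"
  fint :: "'f \<Rightarrow> 'a list \<Rightarrow> 'a"
  pint :: "'p \<Rightarrow> 'a list \<Rightarrow> real"

definition tuples :: "('s, 'f, 'p, 'a) struct \<Rightarrow> 's list \<Rightarrow> 'a list set" where
  "tuples M ss = {xs. list_all2 (\<lambda>s x. x \<in> carrier M s) ss xs}"

definition tuple_dists ::
  "('s, 'f, 'p, 'a) struct \<Rightarrow> 's list \<Rightarrow> 'a list \<Rightarrow> 'a list \<Rightarrow> real list" where
  "tuple_dists M ss xs ys = map2 (\<lambda>s (x, y). mdist M s x y) ss (zip xs ys)"

definition is_structure :: "('s, 'f, 'p) lang \<Rightarrow> ('s, 'f, 'p, 'a) struct \<Rightarrow> bool" where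
  "is_structure L M \<longleftrightarrow>
     (\<forall>s. carrier M s \<noteq> {} \<and>
          Metric_space (carrier M s) (mdist M s) \<and>
          Metric_space.mcomplete (carrier M s) (mdist M s) \<and>
          (\<forall>x\<in>carrier M s. \<forall>y\<in>carrier M s. mdist M s x y \<le> diam_bound L s)) \<and>
     (\<forall>f\<in>funs L. \<forall>xs\<in>tuples M (fdom L f).
          fint M f xs \<in> carrier M (fcod L f) \<and>
          (\<forall>ys\<in>tuples M (fdom L f).
             mdist M (fcod L f) (fint M f xs) (fint M f ys)
               \<le> fmodulus L f (tuple_dists M (fdom L f) xs ys))) \<and>
     (\<forall>p\<in>preds L. \<forall>xs\<in>tuples M (pdom L p).
          pint M p xs \<in> {plower L p..pupper L p} \<and>
          (\<forall>ys\<in>tuples M (pdom L p).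
             \<bar>pint M p xs - pint M p ys\<bar>
               \<le> pmodulus L p (tuple_dists M (pdom L p) xs ys)))"

section \<open>Affine formulas\<close>

text \<open>A variable is a pair of its sort and an index.\<close>

type_synonym 's var = "'s \<times> nat"

datatype ('s, 'f) tm = Var "'s var" | App 'f "('s, 'f) tm list"

datatype ('s, 'f, 'p) aform =
    Dist 's "('s, 'f) tm" "('s, 'f) tm"
  | Pred 'p "('s, 'f) tm list"
  | Const real
  | Add "('s, 'f, 'p) aform" "('s, 'f, 'p) aform"
  | Scale real "('s, 'f, 'p) aform"
  | QSup "'s var" "('s, 'f, 'p) aform"
  | QInf "'s var" "('s, 'f, 'p) aform"

fun tm_sort :: "('s, 'f, 'p) lang \<Rightarrow> ('s, 'f) tm \<Rightarrow> 's" where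
  "tm_sort L (Var x) = fst x"
| "tm_sort L (App f ts) = fcod L f"

fun wf_tm :: "('s, 'f, 'p) lang \<Rightarrow> ('s, 'f) tm \<Rightarrow> bool" where
  "wf_tm L (Var x) \<longleftrightarrow> True"
| "wf_tm L (App f ts) \<longleftrightarrow>
     f \<in> funs L \<and> map (tm_sort L) ts = fdom L f \<and> (\<forall>t\<in>set ts. wf_tm L t)"

fun affine_formula :: "('s, 'f, 'p) lang \<Rightarrow> ('s, 'f, 'p) aform \<Rightarrow> bool" where
  "affine_formula L (Dist s t u) \<longleftrightarrow>
     wf_tm L t \<and> wf_tm L u \<and> tm_sort L t = s \<and> tm_sort L u = s"
| "affine_formula L (Pred p ts) \<longleftrightarrow>
     p \<in> preds L \<and> map (tm_sort L) ts = pdom L p \<and> (\<forall>t\<in>set ts. wf_tm L t)"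
| "affine_formula L (Const r) \<longleftrightarrow> True"
| "affine_formula L (Add \<phi> \<psi>) \<longleftrightarrow> affine_formula L \<phi> \<and> affine_formula L \<psi>"
| "affine_formula L (Scale r \<phi>) \<longleftrightarrow> affine_formula L \<phi>"
| "affine_formula L (QSup x \<phi>) \<longleftrightarrow> affine_formula L \<phi>"
| "affine_formula L (QInf x \<phi>) \<longleftrightarrow> affine_formula L \<phi>"

fun tm_vars :: "('s, 'f) tm \<Rightarrow> 's var set" where
  "tm_vars (Var x) = {x}"
| "tm_vars (App f ts) = (\<Union>t\<in>set ts. tm_vars t)"

fun free_vars :: "('s, 'f, 'p) aform \<Rightarrow> 's var set" where
  "free_vars (Dist s t u) = tm_vars t \<union> tm_vars u"
| "free_vars (Pred p ts) = (\<Union>t\<in>set ts. tm_vars t)"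
| "free_vars (Const r) = {}"
| "free_vars (Add \<phi> \<psi>) = free_vars \<phi> \<union> free_vars \<psi>"
| "free_vars (Scale r \<phi>) = free_vars \<phi>"
| "free_vars (QSup x \<phi>) = free_vars \<phi> - {x}"
| "free_vars (QInf x \<phi>) = free_vars \<phi> - {x}"

fun tm_val :: "('s, 'f, 'p, 'a) struct \<Rightarrow> ('s var \<Rightarrow> 'a) \<Rightarrow> ('s, 'f) tm \<Rightarrow> 'a" where
  "tm_val M v (Var x) = v x"
| "tm_val M v (App f ts) = fint M f (map (tm_val M v) ts)"

fun val :: "('s, 'f, 'p, 'a) struct \<Rightarrow> ('s var \<Rightarrow> 'a) \<Rightarrow> ('s, 'f, 'p) aform \<Rightarrow> real" where
  "val M v (Dist s t u) = mdist M s (tm_val M v t) (tm_val M v u)"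
| "val M v (Pred p ts) = pint M p (map (tm_val M v) ts)"
| "val M v (Const r) = r"
| "val M v (Add \<phi> \<psi>) = val M v \<phi> + val M v \<psi>"
| "val M v (Scale r \<phi>) = r * val M v \<phi>"
| "val M v (QSup x \<phi>) = (SUP c\<in>carrier M (fst x). val M (v(x := c)) \<phi>)"
| "val M v (QInf x \<phi>) = (INF c\<in>carrier M (fst x). val M (v(x := c)) \<phi>)"

section \<open>Affine theories\<close>

definition affine_sentence :: "('s, 'f, 'p) lang \<Rightarrow> ('s, 'f, 'p) aform \<Rightarrow> bool" where
  "affine_sentence L \<sigma> \<longleftrightarrow> affine_formula L \<sigma> \<and> free_vars \<sigma> = {}"

text \<open>A theory is given by the set of the sentences \<open>\<sigma>\<close> for which it contains the condition
  \<open>\<sigma> \<ge> 0\<close>.\<close>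

definition affine_theory :: "('s, 'f, 'p) lang \<Rightarrow> ('s, 'f, 'p) aform set \<Rightarrow> bool" where
  "affine_theory L T \<longleftrightarrow> (\<forall>\<sigma>\<in>T. affine_sentence L \<sigma>)"

text \<open>The value of a sentence does not depend on the assignment.\<close>

definition models ::
  "('s, 'f, 'p) lang \<Rightarrow> ('s, 'f, 'p, 'a) struct \<Rightarrow> ('s, 'f, 'p) aform set \<Rightarrow> bool" where
  "models L M T \<longleftrightarrow> is_structure L M \<and> (\<forall>\<sigma>\<in>T. \<forall>v. 0 \<le> val M v \<sigma>)"

text \<open>Models must be taken in some type. By the downward Loewenheim-Skolem theorem every structure
  has an affinely elementary substructure all of whose sorts have density character at most
  \<open>\<kappa> = \<bar>'s\<bar> + \<bar>'f\<bar> + \<bar>'p\<bar> + \<aleph>\<^sub>0\<close>, hence cardinality at most \<open>\<kappa>\<close> to the power \<open>\<aleph>\<^sub>0\<close>. So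
  the type below is large enough for the definition of completeness to be equivalent to the one
  which refers to models in arbitrary types.\<close>

type_synonym ('s, 'f, 'p) small = "nat \<Rightarrow> 's + 'f + 'p + nat"

definition complete_theory :: "('s, 'f, 'p) lang \<Rightarrow> ('s, 'f, 'p) aform set \<Rightarrow> bool" where
  "complete_theory L T \<longleftrightarrow>
     (\<exists>M :: ('s, 'f, 'p, ('s, 'f, 'p) small) struct. models L M T) \<and>
     (\<forall>\<sigma>. affine_sentence L \<sigma> \<longrightarrow>
        (\<exists>r. \<forall>(M :: ('s, 'f, 'p, ('s, 'f, 'p) small) struct) v.
               models L M T \<longrightarrow> val M v \<sigma> = r))"

section \<open>Affine extensions\<close>

text \<open>Since \<open>M\<close> and its extension \<open>N\<close> may live in different types, the inclusion of \<open>M\<close> in \<open>N\<close> is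
  represented by a map \<open>h\<close> (one component for each sort), which identifies \<open>M\<close> with a
  substructure of \<open>N\<close>.\<close>

definition substructure_via ::
  "('s, 'f, 'p) lang \<Rightarrow> ('s \<Rightarrow> 'a \<Rightarrow> 'b) \<Rightarrow> ('s, 'f, 'p, 'a) struct \<Rightarrow> ('s, 'f, 'p, 'b) struct \<Rightarrow> bool"
  where
  "substructure_via L h M N \<longleftrightarrow>
     is_structure L M \<and> is_structure L N \<and>
     (\<forall>s. \<forall>x\<in>carrier M s. h s x \<in> carrier N s) \<and>
     (\<forall>s. \<forall>x\<in>carrier M s. \<forall>y\<in>carrier M s. mdist N s (h s x) (h s y) = mdist M s x y) \<and>
     (\<forall>f\<in>funs L. \<forall>xs\<in>tuples M (fdom L f).
        fint N f (map2 h (fdom L f) xs) = h (fcod L f) (fint M f xs)) \<and>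
     (\<forall>p\<in>preds L. \<forall>xs\<in>tuples M (pdom L p).
        pint N p (map2 h (pdom L p) xs) = pint M p xs)"

definition affine_extension_via ::
  "('s, 'f, 'p) lang \<Rightarrow> ('s \<Rightarrow> 'a \<Rightarrow> 'b) \<Rightarrow> ('s, 'f, 'p, 'a) struct \<Rightarrow> ('s, 'f, 'p, 'b) struct \<Rightarrow> bool"
  where
  "affine_extension_via L h M N \<longleftrightarrow>
     substructure_via L h M N \<and>
     (\<forall>\<psi> v. affine_formula L \<psi> \<and> (\<forall>x. v x \<in> carrier M (fst x)) \<longrightarrow>
        val N (\<lambda>x. h (fst x) (v x)) \<psi> = val M v \<psi>)"

section \<open>Affine types\<close>

text \<open>A (possibly infinite) tuple of variables is given by an index set \<open>J\<close> and the sorts \<open>sr j\<close> of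
  its members. The pairs \<open>\<psi>(a,c)\<close>, \<open>\<psi>(b,c)\<close> with \<open>c\<close> a tuple in \<open>A\<close> are the pairs of instances of
  a formula under assignments \<open>v\<close>, \<open>w\<close> which either send a free variable to the same element of \<open>A\<close>
  or send it to \<open>a\<^sub>j\<close> and \<open>b\<^sub>j\<close>, respectively, with the same \<open>j\<close>.\<close>

definition aff_equiv ::
  "('s, 'f, 'p) lang \<Rightarrow> ('s, 'f, 'p, 'a) struct \<Rightarrow> ('s \<Rightarrow> 'a set) \<Rightarrow>
   'j set \<Rightarrow> ('j \<Rightarrow> 's) \<Rightarrow> ('j \<Rightarrow> 'a) \<Rightarrow> ('j \<Rightarrow> 'a) \<Rightarrow> bool" where
  "aff_equiv L M A J sr a b \<longleftrightarrow>
     (\<forall>\<psi> v w. affine_formula L \<psi> \<and>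
        (\<forall>x\<in>free_vars \<psi>.
           (v x = w x \<and> v x \<in> A (fst x)) \<or>
           (\<exists>j\<in>J. sr j = fst x \<and> v x = a j \<and> w x = b j)) \<longrightarrow>
        val M v \<psi> = val M w \<psi>)"

definition enumerates ::
  "'j set \<Rightarrow> ('j \<Rightarrow> 's) \<Rightarrow> ('j \<Rightarrow> 'a) \<Rightarrow> ('s \<Rightarrow> 'a set) \<Rightarrow> bool" where
  "enumerates J sr e B \<longleftrightarrow> (\<forall>s. e ` {j\<in>J. sr j = s} = B s)"

text \<open>Common enumerations can be indexed by the members of one of the two sets, tagged with their
  sorts, so it is no restriction to take the index set in \<open>'s \<times> 'a\<close>.\<close>

definition aff_equiv_sets ::
  "('s, 'f, 'p) lang \<Rightarrow> ('s, 'f, 'p, 'a) struct \<Rightarrow> ('s \<Rightarrow> 'a set) \<Rightarrow>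
   ('s \<Rightarrow> 'a set) \<Rightarrow> ('s \<Rightarrow> 'a set) \<Rightarrow> bool" where
  "aff_equiv_sets L M A B' B \<longleftrightarrow>
     (\<exists>(J :: ('s \<times> 'a) set) sr e' e.
        enumerates J sr e' B' \<and> enumerates J sr e B \<and> aff_equiv L M A J sr e' e)"

text \<open>There is no quantification over types, so the extension is sought in a fixed type, which is
  large enough to hold the completion of a quotient of the power of a structure in \<open>'a\<close> by a set of
  sort-indexed families of maps \<open>'a \<Rightarrow> 'a\<close>, with chosen representatives.\<close>

type_synonym ('s, 'a) large = "nat \<Rightarrow> ('s \<times> 'a \<Rightarrow> 'a) \<Rightarrow> 'a"

end

theory Submission
  imports Defs
begin

text \<open>
  The set \<open>B'\<close> is obtained by averaging. If \<open>\<sigma>\<close> were an automorphism over \<open>A\<close> taking \<open>a\<close> to \<open>b\<close>, then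
  each translate \<open>\<sigma>\<^sup>n B\<close> would have the type of \<open>B\<close> over \<open>A\<close>, and
  \<open>\<psi>(\<sigma>\<^sup>n B, b) = \<psi>(\<sigma>\<^sup>n\<^sup>-\<^sup>1 B, a)\<close>; so the averages of \<open>\<psi>(\<sigma>\<^sup>n B, a)\<close> and of \<open>\<psi>(\<sigma>\<^sup>n B, b)\<close>
  over \<open>n < k\<close> would differ by a telescoping sum of order \<open>1 / k\<close>. In affine logic a limit of averages
  of types is again a type, and its realization is the required \<open>B'\<close>. There need not be such a \<open>\<sigma>\<close>, but
  a mean (finitely additive probability measure) on the set of all maps \<open>i : M \<rightarrow> M\<close> fixing \<open>A\<close>
  pointwise takes the place of the averages. It is asked to satisfy, for all affine \<open>\<phi>\<close> and \<open>\<psi>\<close> and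
  all tuples \<open>m\<close>,

  \<^item> the mean of \<open>\<phi>(i m)\<close> is \<open>\<phi>(m)\<close>;
  \<^item> \<open>\<psi>(i m, a)\<close> and \<open>\<psi>(i m, b)\<close> have the same mean.

  These are linear conditions. By a Hahn--Banach argument (\<open>exists_mean_vanishing_on\<close>) they can be met
  unless some \<open>\<phi>(i m) - \<phi>(m) + \<psi>(i m, a) - \<psi>(i m, b)\<close> is uniformly negative in \<open>i\<close>. This is excluded by
  \<open>no_uniform_gap\<close>, where the telescoping sum reappears as an induction: by
  \<open>upper_bound_transfers\<close>, a bound valid for \<open>a\<close> and all \<open>i\<close> is valid for \<open>b\<close> and all \<open>i\<close>, being a bound for an
  affine formula over \<open>A\<close>; the gap then improves the bound for \<open>a\<close> at every step, beyond all limits.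

  The extension \<open>N\<close> is the power of \<open>M\<close> by the mean: its elements are families of elements of \<open>M\<close>
  indexed by the maps \<open>i\<close>, and an affine formula takes the mean of its pointwise values (\<open>power_val\<close>).
  Concavity of the moduli enters through Jensen's inequality for means (\<open>jensen\<close>). For completeness of \<open>N\<close>
  the index set is multiplied by the natural numbers, with an ultrafilter limit (\<open>diagonal_limit\<close>). The
  constant families embed \<open>M\<close> into \<open>N\<close>, and \<open>B'\<close> consists of the families \<open>i \<mapsto> i m\<close> with \<open>m\<close> in \<open>B\<close>.
\<close>

section \<open>Means\<close>

definition bfun :: "('i \<Rightarrow> real) \<Rightarrow> bool" where
  "bfun g \<longleftrightarrow> (\<exists>K. \<forall>i. \<bar>g i\<bar> \<le> K)"

lemma bfunI: "(\<And>i. \<bar>g i\<bar> \<le> K) \<Longrightarrow> bfun g"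
  unfolding bfun_def by blast

lemma bfunE:
  assumes "bfun g"
  obtains K where "0 \<le> K" "\<And>i. \<bar>g i\<bar> \<le> K"
proof -
  obtain K where K: "\<And>i. \<bar>g i\<bar> \<le> K" using assms unfolding bfun_def by blast
  have "0 \<le> K" using K[of undefined] by linarith
  with K that show thesis by blast
qed

lemma bfun_const [simp]: "bfun (\<lambda>i. c)"
  by (rule bfunI[of _ "\<bar>c\<bar>"]) simp

lemma bfun_add: assumes "bfun f" "bfun g" shows "bfun (\<lambda>i. f i + g i)"
proof -
  obtain K where K: "\<And>i. \<bar>f i\<bar> \<le> K" using assms(1) by (rule bfunE) blast
  obtain K' where K': "\<And>i. \<bar>g i\<bar> \<le> K'" using assms(2) by (rule bfunE) blast
  show ?thesis
  proof (rule bfunI)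
    show "\<bar>f i + g i\<bar> \<le> K + K'" for i
      using K[of i] K'[of i] by linarith
  qed
qed

lemma bfun_scale: assumes "bfun f" shows "bfun (\<lambda>i. c * f i)"
proof -
  obtain K where K: "\<And>i. \<bar>f i\<bar> \<le> K" using assms by (rule bfunE) blast
  show ?thesis
    by (rule bfunI[of _ "\<bar>c\<bar> * K"]) (simp add: abs_mult K mult_left_mono)
qed

lemma bfun_diff: assumes "bfun f" "bfun g" shows "bfun (\<lambda>i. f i - g i)"
  using bfun_add[OF assms(1) bfun_scale[OF assms(2), of "-1"]] by simp

lemma bfun_abs: "bfun f \<Longrightarrow> bfun (\<lambda>i. \<bar>f i\<bar>)"
  unfolding bfun_def by simp

lemma bfun_sum: "(\<And>s. s \<in> S \<Longrightarrow> bfun (f s)) \<Longrightarrow> bfun (\<lambda>i. \<Sum>s\<in>S. f s i)"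
  by (induction S rule: infinite_finite_induct) (auto intro: bfun_add)

lemma bfun_comp: "bfun g \<Longrightarrow> bfun (\<lambda>i. g (h i))"
  unfolding bfun_def by blast

text \<open>A mean is integration against a finitely additive probability measure on the power set of
  \<open>'i\<close>. As it integrates every bounded function, witnesses may later be chosen independently at each
  index, with no question of measurability.\<close>

locale mean =
  fixes \<Lambda> :: "('i \<Rightarrow> real) \<Rightarrow> real"
  assumes add: "bfun f \<Longrightarrow> bfun g \<Longrightarrow> \<Lambda> (\<lambda>i. f i + g i) = \<Lambda> f + \<Lambda> g"
    and scale: "bfun f \<Longrightarrow> \<Lambda> (\<lambda>i. c * f i) = c * \<Lambda> f"
    and nonneg: "bfun f \<Longrightarrow> (\<And>i. 0 \<le> f i) \<Longrightarrow> 0 \<le> \<Lambda> f"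
    and one: "\<Lambda> (\<lambda>i. 1) = 1"
begin

lemma const [simp]: "\<Lambda> (\<lambda>i. c) = c"
  using scale[of "\<lambda>i. 1" c] one by simp

lemma diff: "bfun f \<Longrightarrow> bfun g \<Longrightarrow> \<Lambda> (\<lambda>i. f i - g i) = \<Lambda> f - \<Lambda> g"
  using add[of f "\<lambda>i. -1 * g i"] scale[of g "-1"] bfun_scale[of g "-1"] by simp

lemma mono: "bfun f \<Longrightarrow> bfun g \<Longrightarrow> (\<And>i. f i \<le> g i) \<Longrightarrow> \<Lambda> f \<le> \<Lambda> g"
  using nonneg[of "\<lambda>i. g i - f i"] diff[of g f] bfun_diff[of g f] by simp

lemma sum: "(\<And>s. s \<in> S \<Longrightarrow> bfun (f s)) \<Longrightarrow> \<Lambda> (\<lambda>i. \<Sum>s\<in>S. f s i) = (\<Sum>s\<in>S. \<Lambda> (f s))"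
  by (induction S rule: infinite_finite_induct) (auto simp: add bfun_sum)

lemma le_const: "bfun f \<Longrightarrow> (\<And>i. f i \<le> c) \<Longrightarrow> \<Lambda> f \<le> c"
  using mono[of f "\<lambda>i. c"] by simp

lemma ge_const: "bfun f \<Longrightarrow> (\<And>i. c \<le> f i) \<Longrightarrow> c \<le> \<Lambda> f"
  using mono[of "\<lambda>i. c" f] by simp

lemma abs_le: assumes "bfun f" shows "\<bar>\<Lambda> f\<bar> \<le> \<Lambda> (\<lambda>i. \<bar>f i\<bar>)"
proof -
  have "\<Lambda> f \<le> \<Lambda> (\<lambda>i. \<bar>f i\<bar>)" by (rule mono) (auto intro: bfun_abs assms)
  moreover have "\<Lambda> (\<lambda>i. -1 * f i) \<le> \<Lambda> (\<lambda>i. \<bar>f i\<bar>)"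
    by (rule mono) (auto intro!: bfun_abs assms bfun_scale[of f "-1", simplified])
  ultimately show ?thesis using scale[OF assms, of "-1"] by simp
qed

end

subsection \<open>Existence of means vanishing on a subspace\<close>

definition bounded_subspace :: "('i \<Rightarrow> real) set \<Rightarrow> bool" where
  "bounded_subspace W \<longleftrightarrow> (\<lambda>i. 0) \<in> W \<and> (\<forall>g\<in>W. bfun g)
     \<and> (\<forall>f\<in>W. \<forall>g\<in>W. (\<lambda>i. f i + g i) \<in> W) \<and> (\<forall>f\<in>W. \<forall>c. (\<lambda>i. c * f i) \<in> W)"

text \<open>The supremum of each member of \<open>W\<close> is nonnegative. Since a mean is at most the supremum, this is
  necessary for some mean to vanish on \<open>W\<close>; for subspaces it will turn out to be sufficient.\<close>

definition sup_nonneg :: "('i \<Rightarrow> real) set \<Rightarrow> bool" where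
  "sup_nonneg W \<longleftrightarrow> (\<forall>g\<in>W. \<forall>e>0. \<exists>i. - e < g i)"

lemma exists_maximal_sup_nonneg:
  assumes "bounded_subspace V" "sup_nonneg V"
  shows "\<exists>W. V \<subseteq> W \<and> bounded_subspace W \<and> sup_nonneg W
    \<and> (\<forall>X. W \<subseteq> X \<and> bounded_subspace X \<and> sup_nonneg X \<longrightarrow> X = W)"
proof -
  let ?A = "{W. V \<subseteq> W \<and> bounded_subspace W \<and> sup_nonneg W}"
  have "\<exists>M\<in>?A. \<forall>X\<in>?A. M \<subseteq> X \<longrightarrow> X = M"
  proof (rule subset_Zorn_nonempty)
    show "?A \<noteq> {}" using assms by blast
    fix C assume C: "C \<noteq> {}" and ch: "subset.chain ?A C"
    have CA: "C \<subseteq> ?A" using ch by (rule subset.chain_def[THEN iffD1, THEN conjunct1])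
    have lin: "X \<subseteq> Y \<or> Y \<subseteq> X" if "X \<in> C" "Y \<in> C" for X Y
      using ch that unfolding subset_chain_def by blast
    obtain X0 where X0: "X0 \<in> C" using C by blast
    have "V \<subseteq> \<Union>C" using X0 CA by blast
    moreover have "bounded_subspace (\<Union>C)"
      unfolding bounded_subspace_def
    proof (intro conjI ballI allI)
      show "(\<lambda>i. 0) \<in> \<Union>C" using X0 CA unfolding bounded_subspace_def by blast
    next
      fix g assume "g \<in> \<Union>C" then show "bfun g" using CA unfolding bounded_subspace_def by blast
    next
      fix f g assume "f \<in> \<Union>C" "g \<in> \<Union>C"
      then obtain X Y where XY: "X \<in> C" "f \<in> X" "Y \<in> C" "g \<in> Y" by blast
      then obtain Z where Z: "Z \<in> C" "f \<in> Z" "g \<in> Z" using lin[of X Y] by blast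
      then have "bounded_subspace Z" using CA by blast
      then have "(\<lambda>i. f i + g i) \<in> Z" using Z unfolding bounded_subspace_def by blast
      then show "(\<lambda>i. f i + g i) \<in> \<Union>C" using Z by blast
    next
      fix f c assume "f \<in> \<Union>C"
      then obtain X where X: "X \<in> C" "f \<in> X" by blast
      then have "bounded_subspace X" using CA by blast
      then have "(\<lambda>i. c * f i) \<in> X" using X unfolding bounded_subspace_def by blast
      then show "(\<lambda>i. c * f i) \<in> \<Union>C" using X by blast
    qed
    moreover have "sup_nonneg (\<Union>C)"
      using CA unfolding sup_nonneg_def by blast
    ultimately show "\<Union>C \<in> ?A" by blast
  qed
  then show ?thesis by simp (meson subset_trans)
qed

text \<open>A maximal \<open>W\<close> is a complement of the line of constant functions. For given \<open>g\<close>, the constant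
  \<open>c\<close> is the infimum over \<open>w \<in> W\<close> of the supremum of \<open>g - w\<close>. This is at least the infimum of \<open>g - w\<close>
  for each \<open>w\<close>, because two members of \<open>W\<close> cannot be uniformly separated; so no multiple of \<open>g - c\<close>,
  of either sign, can be added to \<open>W\<close> to produce a function which is uniformly negative.\<close>

lemma maximal_sup_nonneg_hyperplane:
  fixes W :: "('i \<Rightarrow> real) set"
  assumes W: "bounded_subspace W" "sup_nonneg W"
    and max: "\<And>X. W \<subseteq> X \<Longrightarrow> bounded_subspace X \<Longrightarrow> sup_nonneg X \<Longrightarrow> X = W"
    and g: "bfun g"
  shows "\<exists>c. (\<lambda>i. g i - c) \<in> W"
proof -
  have W0: "(\<lambda>i. 0) \<in> W" using W unfolding bounded_subspace_def by blast
  have Wadd: "(\<lambda>i. u i + w i) \<in> W" if "u \<in> W" "w \<in> W" for u w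
    using W that unfolding bounded_subspace_def by blast
  have Wsc: "(\<lambda>i. t * w i) \<in> W" if "w \<in> W" for w t
    using W that unfolding bounded_subspace_def by blast
  have Wb: "bfun w" if "w \<in> W" for w using W that unfolding bounded_subspace_def by blast
  have Wsup: "\<exists>i. - e < w i" if "w \<in> W" "e > 0" for w e
    using W that unfolding sup_nonneg_def by blast
  define R where "R = {r. \<exists>w\<in>W. \<forall>i. g i - w i \<le> r}"
  define c where "c = Inf R"
  obtain K where K: "\<And>i. \<bar>g i\<bar> \<le> K" using g by (rule bfunE) blast
  have "K \<in> R" unfolding R_def using W0 K by (auto intro!: bexI[of _ "\<lambda>i. 0"] simp: abs_le_iff)
  have lower: "l \<le> r" if r: "r \<in> R" and w: "w \<in> W" "\<And>i. l \<le> g i - w i" for l r w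
  proof (rule ccontr)
    assume "\<not> l \<le> r"
    obtain w' where w': "w' \<in> W" "\<And>i. g i - w' i \<le> r" using r unfolding R_def by blast
    have "(\<lambda>i. w i + -1 * w' i) \<in> W" by (intro Wadd Wsc w w')
    from Wsup[OF this, of "l - r"] \<open>\<not> l \<le> r\<close> obtain i where "- (l - r) < w i + -1 * w' i" by auto
    with w(2)[of i] w'(2)[of i] show False by linarith
  qed
  have bdd: "bdd_below R"
  proof (rule bdd_belowI[of _ "-K"])
    fix r assume "r \<in> R" then show "- K \<le> r"
    proof (rule lower)
      show "- K \<le> g i - 0" for i using K[of i] by linarith
    qed (rule W0)
  qed
  have c_ge: "l \<le> c" if "w \<in> W" "\<And>i. l \<le> g i - w i" for l w
    unfolding c_def using \<open>K \<in> R\<close> by (intro cInf_greatest) (auto intro: lower that)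
  have c_le: "c \<le> r" if "w \<in> W" "\<And>i. g i - w i \<le> r" for r w
    unfolding c_def using that bdd by (intro cInf_lower) (auto simp: R_def)
  define X where "X = {h. \<exists>w\<in>W. \<exists>t. h = (\<lambda>i. w i + t * (g i - c))}"
  have "W \<subseteq> X" unfolding X_def by (auto intro!: exI[of _ 0])
  moreover have "bounded_subspace X"
    unfolding bounded_subspace_def
  proof (intro conjI ballI allI)
    show "(\<lambda>i. 0) \<in> X" using \<open>W \<subseteq> X\<close> W0 by blast
    fix f assume "f \<in> X"
    then obtain w t where w: "w \<in> W" and f: "f = (\<lambda>i. w i + t * (g i - c))" unfolding X_def by blast
    show "bfun f" unfolding f by (intro bfun_add bfun_scale bfun_diff Wb w g bfun_const)
    show "(\<lambda>i. s * f i) \<in> X" for s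
      unfolding X_def mem_Collect_eq
      by (intro bexI[of _ "\<lambda>i. s * w i"] exI[of _ "s * t"] Wsc w) (auto simp: f algebra_simps)
    fix f' assume "f' \<in> X"
    then obtain w' t' where w': "w' \<in> W" and f': "f' = (\<lambda>i. w' i + t' * (g i - c))"
      unfolding X_def by blast
    show "(\<lambda>i. f i + f' i) \<in> X"
      unfolding X_def mem_Collect_eq
      by (intro bexI[of _ "\<lambda>i. w i + w' i"] exI[of _ "t + t'"] Wadd w w')
        (auto simp: f f' algebra_simps)
  qed
  moreover have "sup_nonneg X"
    unfolding sup_nonneg_def
  proof (intro ballI allI impI)
    fix f and e :: real assume "f \<in> X" and e: "e > 0"
    then obtain w t where w: "w \<in> W" and f: "f = (\<lambda>i. w i + t * (g i - c))" unfolding X_def by blast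
    show "\<exists>i. - e < f i"
    proof (rule ccontr)
      assume "\<not> (\<exists>i. - e < f i)"
      then have le: "w i + t * (g i - c) \<le> - e" for i by (force simp: f not_less)
      consider "t = 0" | "t > 0" | "t < 0" by linarith
      then show False
      proof cases
        case 1
        then have "w i \<le> - e" for i using le[of i] by simp
        moreover obtain i where "- e < w i" using Wsup[OF w e] by blast
        ultimately show ?thesis by (meson not_less)
      next
        case 2
        have "g i - (- 1 / t) * w i \<le> c - e / t" for i
        proof -
          have "(w i + t * (g i - c)) / t \<le> - e / t" using le[of i] 2 by (intro divide_right_mono) auto
          then show ?thesis using 2 by (simp add: add_divide_distrib)
        qed
        from c_le[OF Wsc[OF w] this] show ?thesis using 2 e by (simp add: field_simps)
      next
        case 3
        have "c + e / (- t) \<le> g i - (- 1 / t) * w i" for i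
        proof -
          have "- e / t \<le> (w i + t * (g i - c)) / t" using le[of i] 3 by (intro divide_right_mono_neg) auto
          then show ?thesis using 3 by (simp add: add_divide_distrib)
        qed
        from c_ge[OF Wsc[OF w] this] show ?thesis using 3 e by (simp add: field_simps)
      qed
    qed
  qed
  ultimately have "X = W" by (rule max)
  moreover have "(\<lambda>i. g i - c) \<in> X"
    unfolding X_def mem_Collect_eq
    by (intro bexI[of _ "\<lambda>i. 0"] exI[of _ 1]) (auto simp: W0)
  ultimately show ?thesis by blast
qed

text \<open>This is the form of the Hahn--Banach theorem that is needed: the mean of \<open>g\<close> is the constant to
  which \<open>g\<close> is congruent modulo a maximal subspace containing \<open>V\<close>.\<close>

theorem exists_mean_vanishing_on:
  fixes V :: "('i \<Rightarrow> real) set"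
  assumes "bounded_subspace V" "sup_nonneg V"
  obtains \<Lambda> where "mean \<Lambda>" "\<And>g. g \<in> V \<Longrightarrow> \<Lambda> g = 0"
proof -
  obtain W where "V \<subseteq> W" and W: "bounded_subspace W" "sup_nonneg W"
    and max: "\<And>X. W \<subseteq> X \<Longrightarrow> bounded_subspace X \<Longrightarrow> sup_nonneg X \<Longrightarrow> X = W"
    using exists_maximal_sup_nonneg[OF assms] by (elim exE conjE) (rule that, auto)
  have Wadd: "(\<lambda>i. u i + w i) \<in> W" if "u \<in> W" "w \<in> W" for u w
    using W that unfolding bounded_subspace_def by blast
  have Wsc: "(\<lambda>i. t * w i) \<in> W" if "w \<in> W" for w t
    using W that unfolding bounded_subspace_def by blast
  have Wsup: "\<not> (\<forall>i. w i \<le> - e)" if "w \<in> W" "e > 0" for w e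
    using W that unfolding sup_nonneg_def by (auto simp: not_le)
  define \<Lambda> where "\<Lambda> g = (SOME c. (\<lambda>i. g i - c) \<in> W)" for g
  have in_W: "(\<lambda>i. g i - \<Lambda> g) \<in> W" if "bfun g" for g
    unfolding \<Lambda>_def by (rule someI_ex[OF maximal_sup_nonneg_hyperplane[OF W max that]])
  have unique: "\<Lambda> g = c" if "(\<lambda>i. g i - c) \<in> W" for g c
  proof -
    have d: "(\<lambda>i. g i - \<Lambda> g) \<in> W" unfolding \<Lambda>_def by (rule someI[of "\<lambda>c. (\<lambda>i. g i - c) \<in> W", OF that])
    have "(\<lambda>i. t * ((g i - \<Lambda> g) + -1 * (g i - c))) \<in> W" for t
      by (intro Wsc Wadd d that)
    then have const: "(\<lambda>i. t * (c - \<Lambda> g)) \<in> W" for t by simp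
    show ?thesis
    proof (rule ccontr)
      assume "\<Lambda> g \<noteq> c"
      \<comment> \<open>Two different constants would put the constant function \<open>- 1\<close> into \<open>W\<close>.\<close>
      then show False using Wsup[OF const[of "- 1 / (c - \<Lambda> g)"], of 1] by simp
    qed
  qed
  have "mean \<Lambda>"
  proof
    fix f g :: "'i \<Rightarrow> real" assume "bfun f" "bfun g"
    then have "(\<lambda>i. (f i - \<Lambda> f) + (g i - \<Lambda> g)) \<in> W" by (intro Wadd in_W)
    then show "\<Lambda> (\<lambda>i. f i + g i) = \<Lambda> f + \<Lambda> g" by (intro unique) (simp add: algebra_simps)
  next
    fix f :: "'i \<Rightarrow> real" and c assume "bfun f"
    then have "(\<lambda>i. c * (f i - \<Lambda> f)) \<in> W" by (intro Wsc in_W)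
    then show "\<Lambda> (\<lambda>i. c * f i) = c * \<Lambda> f" by (intro unique) (simp add: algebra_simps)
  next
    fix f :: "'i \<Rightarrow> real" assume f: "bfun f" "\<And>i. 0 \<le> f i"
    show "0 \<le> \<Lambda> f"
    proof (rule ccontr)
      assume "\<not> 0 \<le> \<Lambda> f"
      moreover have "(\<lambda>i. -1 * (f i - \<Lambda> f)) \<in> W" using f by (intro Wsc in_W)
      ultimately show False using Wsup[of "\<lambda>i. -1 * (f i - \<Lambda> f)" "- \<Lambda> f"] f by simp
    qed
  next
    show "\<Lambda> (\<lambda>i. 1) = 1" using W by (intro unique) (simp add: bounded_subspace_def)
  qed
  moreover have "\<Lambda> g = 0" if "g \<in> V" for g
    using that \<open>V \<subseteq> W\<close> by (intro unique) auto
  ultimately show thesis by (rule that)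
qed

subsection \<open>Jensen's inequality\<close>

lemma orthantI: "length t = n \<Longrightarrow> (\<And>k. k < n \<Longrightarrow> 0 \<le> t ! k) \<Longrightarrow> t \<in> orthant n"
  unfolding orthant_def by (auto simp: in_set_conv_nth)

text \<open>Jensen's inequality for finite convex combinations: one weight is split off and the remaining
  ones are normalized.\<close>

lemma concave_modulus_sum:
  assumes \<Delta>: "concave_modulus n \<Delta>" and "finite S" "S \<noteq> {}"
    and "\<And>i. i \<in> S \<Longrightarrow> 0 \<le> w i" "(\<Sum>i\<in>S. w i) = 1"
    and "\<And>i k. i \<in> S \<Longrightarrow> k < n \<Longrightarrow> 0 \<le> t k i"
  shows "(\<Sum>i\<in>S. w i * \<Delta> (map (\<lambda>k. t k i) [0..<n])) \<le> \<Delta> (map (\<lambda>k. \<Sum>i\<in>S. w i * t k i) [0..<n])"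
  using assms(2-)
proof (induction S arbitrary: w rule: finite_ne_induct)
  case (singleton x)
  then show ?case by simp
next
  case (insert x S)
  define r where "r = (\<Sum>i\<in>S. w i)"
  have wx: "w x = 1 - r" using insert.prems(2) insert.hyps by (simp add: r_def)
  have r: "0 \<le> r" "r \<le> 1"
  proof -
    show "0 \<le> r" unfolding r_def using insert.prems(1) by (intro sum_nonneg) blast
    have "0 \<le> w x" using insert.prems(1) by blast
    then show "r \<le> 1" using wx by linarith
  qed
  show ?case
  proof (cases "r = 0")
    case True
    then have "w i = 0" if "i \<in> S" for i
      using that insert by (auto simp: r_def sum_nonneg_eq_0_iff)
    then show ?thesis using insert.hyps wx True by simp
  next
    case False
    define u where "u i = w i / r" for i
    have IH: "(\<Sum>i\<in>S. u i * \<Delta> (map (\<lambda>k. t k i) [0..<n])) \<le> \<Delta> (map (\<lambda>k. \<Sum>i\<in>S. u i * t k i) [0..<n])"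
      using insert.prems r False by (intro insert.IH) (auto simp: u_def r_def sum_divide_distrib[symmetric])
    have ru: "r * (\<Sum>i\<in>S. u i * f i) = (\<Sum>i\<in>S. w i * f i)" for f
      using False by (simp add: u_def sum_distrib_left)
    have conc: "(1 - r) * \<Delta> (map (\<lambda>k. t k x) [0..<n]) + r * \<Delta> (map (\<lambda>k. \<Sum>i\<in>S. u i * t k i) [0..<n])
       \<le> \<Delta> (map2 (\<lambda>x y. (1 - r) * x + r * y) (map (\<lambda>k. t k x) [0..<n]) (map (\<lambda>k. \<Sum>i\<in>S. u i * t k i) [0..<n]))"
    proof -
      have "map (\<lambda>k. t k x) [0..<n] \<in> orthant n" "map (\<lambda>k. \<Sum>i\<in>S. u i * t k i) [0..<n] \<in> orthant n"
        using insert.prems r by (auto intro!: orthantI sum_nonneg mult_nonneg_nonneg simp: u_def)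
      then show ?thesis using \<Delta> r unfolding concave_modulus_def by auto
    qed
    have eq: "map2 (\<lambda>x y. (1 - r) * x + r * y) (map (\<lambda>k. t k x) [0..<n]) (map (\<lambda>k. \<Sum>i\<in>S. u i * t k i) [0..<n])
       = map (\<lambda>k. \<Sum>i\<in>insert x S. w i * t k i) [0..<n]"
      using insert.hyps by (intro nth_equalityI) (auto simp: wx ru)
    have "(\<Sum>i\<in>insert x S. w i * \<Delta> (map (\<lambda>k. t k i) [0..<n]))
        = (1 - r) * \<Delta> (map (\<lambda>k. t k x) [0..<n]) + r * (\<Sum>i\<in>S. u i * \<Delta> (map (\<lambda>k. t k i) [0..<n]))"
      using insert.hyps by (simp add: wx ru)
    also have "\<dots> \<le> (1 - r) * \<Delta> (map (\<lambda>k. t k x) [0..<n]) + r * \<Delta> (map (\<lambda>k. \<Sum>i\<in>S. u i * t k i) [0..<n])"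
      using IH r by (simp add: mult_left_mono)
    also note conc
    finally show ?thesis unfolding eq .
  qed
qed

context mean
begin

text \<open>Finitely many bounded functions take values in a bounded box, which is covered by finitely many
  cells of side \<open>e\<close>. Concentrating the mass of each cell at one of its points changes the means by at
  most \<open>e\<close>.\<close>

lemma approx_point_masses:
  assumes "finite G" and G: "\<And>g. g \<in> G \<Longrightarrow> bfun g" and "0 < e"
  obtains S w where "finite S" "S \<noteq> {}" "\<And>i. i \<in> S \<Longrightarrow> 0 \<le> w i" "(\<Sum>i\<in>S. w i) = 1"
    "\<And>g. g \<in> G \<Longrightarrow> \<bar>\<Lambda> g - (\<Sum>i\<in>S. w i * g i)\<bar> \<le> e"
proof -
  define cell where "cell i = restrict (\<lambda>g. \<lfloor>g i / e\<rfloor>) G" for i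
  obtain K where K: "\<And>g i. g \<in> G \<Longrightarrow> \<bar>g i\<bar> \<le> K g"
    using G unfolding bfun_def by metis
  have "range cell \<subseteq> PiE G (\<lambda>g. {\<lfloor>- K g / e\<rfloor>..\<lfloor>K g / e\<rfloor>})"
  proof
    fix c assume "c \<in> range cell"
    then obtain i where c: "c = cell i" by blast
    have "\<lfloor>- K g / e\<rfloor> \<le> \<lfloor>g i / e\<rfloor> \<and> \<lfloor>g i / e\<rfloor> \<le> \<lfloor>K g / e\<rfloor>" if "g \<in> G" for g
      using K[OF that, of i] \<open>0 < e\<close> by (intro conjI floor_mono divide_right_mono) auto
    then show "c \<in> PiE G (\<lambda>g. {\<lfloor>- K g / e\<rfloor>..\<lfloor>K g / e\<rfloor>})" unfolding c cell_def by auto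
  qed
  moreover have "finite (PiE G (\<lambda>g. {\<lfloor>- K g / e\<rfloor>..\<lfloor>K g / e\<rfloor>}))"
    using assms(1) by (intro finite_PiE) auto
  ultimately have fin: "finite (range cell)" by (rule finite_subset)
  define p where "p c = (SOME i. cell i = c)" for c
  have p: "cell (p (cell i)) = cell i" for i
    unfolding p_def by (rule someI[of _ i]) simp
  define S where "S = p ` range cell"
  have "finite S" "S \<noteq> {}" using fin by (auto simp: S_def)
  define ind where "ind s i = (if cell i = cell s then 1 else (0::real))" for s i
  have ind_b: "bfun (ind s)" for s by (rule bfunI[of _ 1]) (simp add: ind_def)
  define w where "w s = \<Lambda> (ind s)" for s
  have pick: "(\<Sum>s\<in>S. ind s i * f s) = f (p (cell i))" for i and f :: "_ \<Rightarrow> real"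
  proof -
    have "s = p (cell i)" if "s \<in> S" "cell i = cell s" for s
      using that p by (auto simp: S_def)
    then have "(\<Sum>s\<in>S. ind s i * f s) = (\<Sum>s\<in>{p (cell i)}. ind s i * f s)"
      using \<open>finite S\<close> by (intro sum.mono_neutral_right) (auto simp: ind_def S_def)
    then show ?thesis by (simp add: ind_def p)
  qed
  have "0 \<le> w s" for s unfolding w_def by (rule nonneg[OF ind_b]) (simp add: ind_def)
  have sumw: "(\<Sum>s\<in>S. w s * f s) = \<Lambda> (\<lambda>i. f (p (cell i)))" for f
  proof -
    have "(\<Sum>s\<in>S. w s * f s) = (\<Sum>s\<in>S. \<Lambda> (\<lambda>i. f s * ind s i))"
      by (simp add: w_def scale[OF ind_b] mult.commute)
    also have "\<dots> = \<Lambda> (\<lambda>i. \<Sum>s\<in>S. f s * ind s i)"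
      by (rule sum[symmetric]) (rule bfun_scale[OF ind_b])
    finally show ?thesis using pick[where f = f] by (simp add: mult.commute)
  qed
  show thesis
  proof (rule that[of S w])
    show "(\<Sum>i\<in>S. w i) = 1" using sumw[of "\<lambda>_. 1"] one by simp
  next
    fix g assume "g \<in> G"
    let ?h = "\<lambda>i. g i - g (p (cell i))"
    have "\<bar>?h i\<bar> \<le> e" for i
    proof -
      have "\<lfloor>g i / e\<rfloor> = \<lfloor>g (p (cell i)) / e\<rfloor>"
        using fun_cong[OF p[of i], of g] \<open>g \<in> G\<close> by (simp add: cell_def)
      then have "\<bar>g i / e - g (p (cell i)) / e\<bar> < 1" by linarith
      then show ?thesis using \<open>0 < e\<close> by (simp add: diff_divide_distrib[symmetric] field_simps abs_less_iff abs_le_iff)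
    qed
    moreover have b: "bfun ?h" "bfun (\<lambda>i. g (p (cell i)))" "bfun g"
      using G[OF \<open>g \<in> G\<close>] by (auto intro: bfun_diff bfun_comp[of g])
    ultimately have "\<Lambda> (\<lambda>i. \<bar>?h i\<bar>) \<le> e" by (intro le_const bfun_abs)
    with abs_le[OF b(1)] show "\<bar>\<Lambda> g - (\<Sum>i\<in>S. w i * g i)\<bar> \<le> e"
      by (simp add: sumw diff b)
  qed (use \<open>finite S\<close> \<open>S \<noteq> {}\<close> \<open>\<And>s. 0 \<le> w s\<close> in auto)
qed

text \<open>The finite case passes to arbitrary means by approximation with point masses. The error is
  controlled by subadditivity, monotonicity and continuity of \<open>\<Delta>\<close> at the origin, so that
  continuity of \<open>\<Delta>\<close> on the boundary of the orthant causes no trouble.\<close>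

lemma jensen:
  assumes \<Delta>: "concave_modulus n \<Delta>"
    and g: "\<And>k. k < n \<Longrightarrow> bfun (g k)" "\<And>k i. k < n \<Longrightarrow> 0 \<le> g k i"
  shows "bfun (\<lambda>i. \<Delta> (map (\<lambda>k. g k i) [0..<n]))"
    and "\<Lambda> (\<lambda>i. \<Delta> (map (\<lambda>k. g k i) [0..<n])) \<le> \<Delta> (map (\<lambda>k. \<Lambda> (g k)) [0..<n])"
proof -
  have mono: "\<Delta> (map t [0..<n]) \<le> \<Delta> (map u [0..<n])"
    if "\<And>k. k < n \<Longrightarrow> 0 \<le> t k" "\<And>k. k < n \<Longrightarrow> t k \<le> u k" for t u
  proof -
    have "map t [0..<n] \<in> orthant n" by (rule orthantI) (auto simp: that)
    moreover have "map u [0..<n] \<in> orthant n" by (rule orthantI) (auto intro: order_trans[OF that])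
    moreover have "list_all2 (\<le>) (map t [0..<n]) (map u [0..<n])"
      by (auto simp: list_all2_conv_all_nth that)
    ultimately show ?thesis using \<Delta> unfolding concave_modulus_def by blast
  qed
  have zero: "\<Delta> (map (\<lambda>k. 0) [0..<n]) = 0"
    using \<Delta> by (simp add: concave_modulus_def map_replicate_const)
  obtain K where K: "\<And>k i. k < n \<Longrightarrow> \<bar>g k i\<bar> \<le> K k"
    using g(1) unfolding bfun_def by metis
  show bf: "bfun (\<lambda>i. \<Delta> (map (\<lambda>k. g k i) [0..<n]))"
  proof (rule bfunI)
    fix i
    have "0 \<le> \<Delta> (map (\<lambda>k. g k i) [0..<n])" using mono[of "\<lambda>k. 0" "\<lambda>k. g k i"] g(2) zero by simp
    moreover have "\<Delta> (map (\<lambda>k. g k i) [0..<n]) \<le> \<Delta> (map K [0..<n])"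
      using K g(2) by (intro mono) (auto simp: abs_le_iff)
    ultimately show "\<bar>\<Delta> (map (\<lambda>k. g k i) [0..<n])\<bar> \<le> \<Delta> (map K [0..<n])" by simp
  qed
  let ?D = "\<lambda>i. \<Delta> (map (\<lambda>k. g k i) [0..<n])"
  show "\<Lambda> ?D \<le> \<Delta> (map (\<lambda>k. \<Lambda> (g k)) [0..<n])"
  proof (rule field_le_epsilon)
    fix e :: real assume "0 < e"
    then obtain \<delta> where "\<delta> > 0" and \<delta>: "\<And>t. t \<in> orthant n \<Longrightarrow> \<forall>x\<in>set t. x < \<delta> \<Longrightarrow> \<Delta> t < e / 2"
      using \<Delta> unfolding concave_modulus_def by (metis half_gt_zero)
    obtain S w where S: "finite S" "S \<noteq> {}" "\<And>i. i \<in> S \<Longrightarrow> 0 \<le> w i" "(\<Sum>i\<in>S. w i) = 1"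
      and app: "\<And>h. h \<in> insert ?D (g ` {..<n}) \<Longrightarrow> \<bar>\<Lambda> h - (\<Sum>i\<in>S. w i * h i)\<bar> \<le> min (\<delta> / 2) (e / 2)"
      using \<open>\<delta> > 0\<close> \<open>0 < e\<close> bf g(1)
      by (rule_tac approx_point_masses[of "insert ?D (g ` {..<n})" "min (\<delta> / 2) (e / 2)"]) auto
    define m where "m k = (\<Sum>i\<in>S. w i * g k i)" for k
    define q where "q k = \<bar>\<Lambda> (g k) - m k\<bar>" for k
    have m: "0 \<le> m k" if "k < n" for k
      unfolding m_def using that S g(2) by (intro sum_nonneg mult_nonneg_nonneg) auto
    have q: "0 \<le> q k" "q k < \<delta>" if "k < n" for k
      using app[of "g k"] that \<open>\<delta> > 0\<close> by (auto simp: q_def m_def)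
    have \<Lambda>g: "0 \<le> \<Lambda> (g k)" if "k < n" for k
      using that g by (intro nonneg) auto
    have "\<Lambda> ?D \<le> (\<Sum>i\<in>S. w i * ?D i) + e / 2"
      using app[of ?D, OF insertI1] unfolding abs_le_iff by linarith
    also have "(\<Sum>i\<in>S. w i * ?D i) \<le> \<Delta> (map m [0..<n])"
      using concave_modulus_sum[OF \<Delta> S, of g] g(2) by (simp add: m_def[abs_def])
    also have "\<dots> \<le> \<Delta> (map (\<lambda>k. \<Lambda> (g k) + q k) [0..<n])"
      using m by (intro mono) (auto simp: q_def)
    also have "map (\<lambda>k. \<Lambda> (g k) + q k) [0..<n] = map2 (+) (map (\<lambda>k. \<Lambda> (g k)) [0..<n]) (map q [0..<n])"
      by (intro nth_equalityI) auto
    also have "\<Delta> \<dots> \<le> \<Delta> (map (\<lambda>k. \<Lambda> (g k)) [0..<n]) + \<Delta> (map q [0..<n])"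
    proof -
      have "map (\<lambda>k. \<Lambda> (g k)) [0..<n] \<in> orthant n" "map q [0..<n] \<in> orthant n"
        by (auto intro!: orthantI \<Lambda>g q)
      then show ?thesis using \<Delta> unfolding concave_modulus_def by blast
    qed
    also have "\<Delta> (map q [0..<n]) \<le> e / 2"
      by (rule less_imp_le, rule \<delta>) (auto intro!: orthantI q)
    finally show "\<Lambda> ?D \<le> \<Delta> (map (\<lambda>k. \<Lambda> (g k)) [0..<n]) + e" by simp
  qed
qed

end

subsection \<open>Ultrafilter limits\<close>

text \<open>Zorn's lemma for the proper filters below \<open>F0\<close>, ordered by inclusion of their sets of eventual
  predicates.\<close>

lemma exists_ultrafilter_le:
  fixes F0 :: "'b filter"
  assumes "F0 \<noteq> bot"
  obtains F where "F \<le> F0" "F \<noteq> bot" "\<And>P. eventually P F \<or> eventually (\<lambda>x. \<not> P x) F"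
proof -
  let ?ev = "\<lambda>F :: 'b filter. {P. eventually P F}"
  let ?A = "?ev ` {F. F \<le> F0 \<and> F \<noteq> bot}"
  have "\<exists>M\<in>?A. \<forall>X\<in>?A. M \<subseteq> X \<longrightarrow> X = M"
  proof (rule subset_Zorn_nonempty)
    show "?A \<noteq> {}" using assms by blast
    fix C assume C: "C \<noteq> {}" and ch: "subset.chain ?A C"
    define B where "B = {F. F \<le> F0 \<and> F \<noteq> bot \<and> ?ev F \<in> C}"
    have CB: "C = ?ev ` B"
    proof
      show "?ev ` B \<subseteq> C" unfolding B_def by auto
      show "C \<subseteq> ?ev ` B"
      proof
        fix Y assume "Y \<in> C"
        moreover have "C \<subseteq> ?A" using ch unfolding subset_chain_def by (rule conjunct1)
        ultimately have "Y \<in> ?A" by (rule set_mp[rotated])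
        then obtain F where "Y = ?ev F" "F \<le> F0" "F \<noteq> bot" by (elim imageE CollectE conjE)
        with \<open>Y \<in> C\<close> show "Y \<in> ?ev ` B" unfolding B_def by (intro image_eqI[of _ _ F]) simp_all
      qed
    qed
    have lin: "F \<le> G \<or> G \<le> F" if "F \<in> B" "G \<in> B" for F G
    proof -
      have *: "X \<subseteq> Y \<or> Y \<subseteq> X" if "X \<in> C" "Y \<in> C" for X Y
        using ch that unfolding subset_chain_def by blast
      have "?ev F \<subseteq> ?ev G \<or> ?ev G \<subseteq> ?ev F"
        using that unfolding B_def by (intro *) simp_all
      then show ?thesis unfolding le_filter_def by auto
    qed
    have ev: "eventually P (Inf B) \<longleftrightarrow> (\<exists>F\<in>B. eventually P F)" for P
    proof (rule eventually_Inf_base)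
      show "B \<noteq> {}" using C CB by blast
      show "\<exists>x\<in>B. x \<le> inf F G" if "F \<in> B" "G \<in> B" for F G
        using lin[OF that] that by (metis inf.absorb1 inf.absorb2 order_refl)
    qed
    have "\<Union>C = ?ev (Inf B)" unfolding CB ev by auto
    moreover have "Inf B \<noteq> bot"
      unfolding trivial_limit_def ev by (auto simp: B_def trivial_limit_def)
    moreover have "Inf B \<le> F0"
    proof -
      obtain F where "F \<in> B" using C CB by blast
      then have "Inf B \<le> F" "F \<le> F0" by (simp_all add: Inf_lower B_def)
      then show ?thesis by (rule order_trans)
    qed
    ultimately show "\<Union>C \<in> ?A" by (intro image_eqI[of _ _ "Inf B"]) simp_all
  qed
  then obtain F where F: "F \<le> F0" "F \<noteq> bot" and "\<forall>X\<in>?A. ?ev F \<subseteq> X \<longrightarrow> X = ?ev F"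
    by (elim bexE imageE CollectE conjE) simp
  then have max: "?ev G = ?ev F" if "G \<le> F0" "G \<noteq> bot" "?ev F \<subseteq> ?ev G" for G
    using that by (metis (mono_tags, lifting) CollectI imageI)
  show thesis
  proof (rule that[OF F])
    fix P
    show "eventually P F \<or> eventually (\<lambda>x. \<not> P x) F"
    proof (rule disjCI)
      assume nP: "\<not> eventually (\<lambda>x. \<not> P x) F"
      let ?G = "inf F (principal (Collect P))"
      have "?G \<noteq> bot" using nP by (simp add: trivial_limit_def eventually_inf_principal)
      moreover have "?G \<le> F0" using F by (simp add: le_infI1)
      moreover have "?ev F \<subseteq> ?ev ?G" by (auto simp: eventually_inf_principal elim: eventually_mono)
      ultimately have "?ev ?G = ?ev F" by (intro max)
      moreover have "P \<in> ?ev ?G" by (simp add: eventually_inf_principal)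
      ultimately show "eventually P F" by blast
    qed
  qed
qed

text \<open>A nonprincipal ultrafilter on the natural numbers.\<close>

locale ultra =
  fixes F :: "nat filter"
  assumes le_sequentially: "F \<le> sequentially"
    and not_bot: "F \<noteq> bot"
    and ultra: "eventually P F \<or> eventually (\<lambda>x. \<not> P x) F"
begin

lemma tendsto_Lim:
  fixes g :: "nat \<Rightarrow> real"
  assumes "bfun g"
  shows "(g \<longlongrightarrow> Lim F g) F"
proof -
  obtain K where K: "0 \<le> K" "\<And>n. \<bar>g n\<bar> \<le> K" using assms by (rule bfunE) blast
  \<comment> \<open>The limit is the supremum of the eventual lower bounds.\<close>
  define R where "R = {r. r \<le> K \<and> eventually (\<lambda>n. r \<le> g n) F}"
  define l where "l = Sup R"
  have "- K \<in> R" unfolding R_def using K by (auto intro!: always_eventually simp: abs_le_iff minus_le_iff)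
  have bdd: "bdd_above R" by (rule bdd_aboveI[of _ K]) (simp add: R_def)
  have "(g \<longlongrightarrow> l) F"
  proof (rule order_tendstoI)
    fix a assume "a < l"
    moreover have "R \<noteq> {}" using \<open>- K \<in> R\<close> by blast
    ultimately obtain r where r: "r \<in> R" "a < r"
      unfolding l_def by (meson less_cSupE)
    then have "eventually (\<lambda>n. r \<le> g n) F" unfolding R_def by blast
    then show "eventually (\<lambda>n. a < g n) F"
      by (rule eventually_mono) (use r in linarith)
  next
    fix a assume "l < a"
    show "eventually (\<lambda>n. g n < a) F"
    proof (rule ccontr)
      assume "\<not> ?thesis"
      then have "eventually (\<lambda>n. \<not> g n < a) F" using ultra by blast
      then have ev: "eventually (\<lambda>n. a \<le> g n) F" by (simp add: not_less)
      then obtain n where "a \<le> g n" using eventually_happens'[OF not_bot] by blast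
      then have "a \<in> R" using ev K(2)[of n] unfolding R_def by auto
      then have "a \<le> l" unfolding l_def using bdd by (rule cSup_upper)
      with \<open>l < a\<close> show False by simp
    qed
  qed
  then show ?thesis using tendsto_Lim[OF not_bot] by blast
qed

lemma Lim_eqI: "(g \<longlongrightarrow> l) F \<Longrightarrow> Lim F g = (l::real)"
  by (rule Topological_Spaces.tendsto_Lim[OF not_bot])

end

lemma exists_ultra: "\<exists>F. ultra F"
proof -
  have "sequentially \<noteq> bot" by simp
  then obtain F :: "nat filter" where "F \<le> sequentially" "F \<noteq> bot"
      "\<And>P. eventually P F \<or> eventually (\<lambda>x. \<not> P x) F"
    by (rule exists_ultrafilter_le) blast
  then have "ultra F" by unfold_locales blast+
  then show ?thesis ..
qed

locale ultra_mean = ultra F + base: mean \<Lambda> for F :: "nat filter" and \<Lambda> :: "('i \<Rightarrow> real) \<Rightarrow> real"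
begin

text \<open>The countable product index serves only to make the power complete: for a general mean, Cauchy
  sequences of families need not converge, but along an ultrafilter limit a diagonal sequence is a
  limit.\<close>

definition umean :: "(nat \<times> 'i \<Rightarrow> real) \<Rightarrow> real" where
  "umean g = Lim F (\<lambda>n. \<Lambda> (\<lambda>i. g (n, i)))"

lemma bfun_slices: assumes "bfun g" shows "bfun (\<lambda>n. \<Lambda> (\<lambda>i. g (n, i)))" "bfun (\<lambda>i. g (n, i))"
proof -
  obtain K where K: "\<And>k. \<bar>g k\<bar> \<le> K" using assms by (rule bfunE) blast
  show s: "bfun (\<lambda>i. g (n, i))" for n using K by (rule bfunI)
  show "bfun (\<lambda>n. \<Lambda> (\<lambda>i. g (n, i)))"
  proof (rule bfunI)
    show "\<bar>\<Lambda> (\<lambda>i. g (n, i))\<bar> \<le> K" for n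
      using base.abs_le[OF s[of n]] base.le_const[OF bfun_abs[OF s[of n]], of K] K by fastforce
  qed
qed

lemma tendsto_umean: "bfun g \<Longrightarrow> ((\<lambda>n. \<Lambda> (\<lambda>i. g (n, i))) \<longlongrightarrow> umean g) F"
  unfolding umean_def by (rule tendsto_Lim) (rule bfun_slices)

lemma umean_le: "bfun g \<Longrightarrow> eventually (\<lambda>n. \<Lambda> (\<lambda>i. g (n, i)) \<le> c) F \<Longrightarrow> umean g \<le> c"
  by (rule tendsto_upperbound[OF tendsto_umean _ not_bot])

lemma umean_less: "bfun g \<Longrightarrow> umean g < c \<Longrightarrow> eventually (\<lambda>n. \<Lambda> (\<lambda>i. g (n, i)) < c) F"
  by (rule order_tendstoD(2)[OF tendsto_umean])

sublocale mean umean
proof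
  fix f g :: "nat \<times> 'i \<Rightarrow> real" assume b: "bfun f" "bfun g"
  show "umean (\<lambda>i. f i + g i) = umean f + umean g"
    unfolding umean_def[of "\<lambda>i. f i + g i"] base.add[OF bfun_slices(2)[OF b(1)] bfun_slices(2)[OF b(2)]]
    by (intro Lim_eqI tendsto_add tendsto_umean b)
next
  fix f :: "nat \<times> 'i \<Rightarrow> real" and c assume b: "bfun f"
  show "umean (\<lambda>i. c * f i) = c * umean f"
    unfolding umean_def[of "\<lambda>i. c * f i"] base.scale[OF bfun_slices(2)[OF b]]
    by (intro Lim_eqI tendsto_mult tendsto_const tendsto_umean b)
next
  fix f :: "nat \<times> 'i \<Rightarrow> real" assume b: "bfun f" "\<And>i. 0 \<le> f i"
  show "0 \<le> umean f"
    by (rule tendsto_lowerbound[OF tendsto_umean[OF b(1)] _ not_bot])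
      (auto intro!: always_eventually base.nonneg bfun_slices b)
next
  show "umean (\<lambda>i. 1) = 1"
    unfolding umean_def base.one by (intro Lim_eqI tendsto_const)
qed

lemma umean_slice: "umean (\<lambda>k. g (snd k)) = \<Lambda> g"
  unfolding umean_def by (simp add: Lim_eqI)

end

section \<open>Values of affine formulas\<close>

lemma finite_tm_vars [simp]: "finite (tm_vars t)"
  by (induction t) auto

lemma finite_free_vars [simp]: "finite (free_vars \<phi>)"
  by (induction \<phi>) auto

lemma tm_val_cong: "(\<And>x. x \<in> tm_vars t \<Longrightarrow> v x = w x) \<Longrightarrow> tm_val M v t = tm_val M w t"
proof (induction t)
  case (App f ts)
  have "map (tm_val M v) ts = map (tm_val M w) ts" by (auto intro!: App.IH App.prems)
  then show ?case by (simp only: tm_val.simps)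
qed simp

lemma val_cong: "(\<And>x. x \<in> free_vars \<phi> \<Longrightarrow> v x = w x) \<Longrightarrow> val M v \<phi> = val M w \<phi>"
proof (induction \<phi> arbitrary: v w)
  case (Dist s t u)
  then show ?case using tm_val_cong[of t v w M] tm_val_cong[of u v w M] by auto
next
  case (Pred p ts)
  have "map (tm_val M v) ts = map (tm_val M w) ts" by (auto intro!: tm_val_cong Pred.prems)
  then show ?case by (simp only: val.simps)
next
  case (Add \<phi> \<psi>)
  have "val M v \<phi> = val M w \<phi>" "val M v \<psi> = val M w \<psi>" by (auto intro!: Add)
  then show ?case by simp
next
  case (Scale r \<phi>)
  have "val M v \<phi> = val M w \<phi>" by (auto intro!: Scale)
  then show ?case by simp
next
  case (QSup x \<phi>)
  have "val M (v(x := c)) \<phi> = val M (w(x := c)) \<phi>" for c by (auto intro!: QSup)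
  then show ?case by simp
next
  case (QInf x \<phi>)
  have "val M (v(x := c)) \<phi> = val M (w(x := c)) \<phi>" for c by (auto intro!: QInf)
  then show ?case by simp
qed simp

definition assigns :: "('s, 'f, 'p, 'a) struct \<Rightarrow> ('s var \<Rightarrow> 'a) \<Rightarrow> bool" where
  "assigns M v \<longleftrightarrow> (\<forall>x. v x \<in> carrier M (fst x))"

lemma assigns_upd: "assigns M v \<Longrightarrow> c \<in> carrier M (fst x) \<Longrightarrow> assigns M (v(x := c))"
  unfolding assigns_def by (simp del: split_paired_All)

lemma assignsD: "assigns M v \<Longrightarrow> v x \<in> carrier M (fst x)"
  unfolding assigns_def by blast

lemma mem_tuplesI: "length xs = length ss \<Longrightarrow> (\<And>k. k < length ss \<Longrightarrow> xs ! k \<in> carrier M (ss ! k))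
    \<Longrightarrow> xs \<in> tuples M ss"
  unfolding tuples_def by (simp add: list_all2_conv_all_nth)

lemma tuplesD:
  assumes "xs \<in> tuples M ss"
  shows "length xs = length ss" "k < length ss \<Longrightarrow> xs ! k \<in> carrier M (ss ! k)"
  using assms unfolding tuples_def by (simp_all add: list_all2_conv_all_nth)

lemma fint_carrier: "is_structure L M \<Longrightarrow> f \<in> funs L \<Longrightarrow> xs \<in> tuples M (fdom L f)
    \<Longrightarrow> fint M f xs \<in> carrier M (fcod L f)"
  unfolding is_structure_def by blast

lemma map_tm_val_tuples:
  assumes "map (tm_sort L) ts = ss" "\<And>t. t \<in> set ts \<Longrightarrow> tm_val M v t \<in> carrier M (tm_sort L t)"
  shows "map (tm_val M v) ts \<in> tuples M ss"
  unfolding assms(1)[symmetric] by (rule mem_tuplesI) (auto intro: assms(2))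

lemma tm_val_carrier:
  assumes "is_structure L M" "assigns M v"
  shows "wf_tm L t \<Longrightarrow> tm_val M v t \<in> carrier M (tm_sort L t)"
proof (induction t)
  case (Var x)
  then show ?case using assms by (simp add: assignsD)
next
  case (App f ts)
  then have "map (tm_val M v) ts \<in> tuples M (fdom L f)" by (intro map_tm_val_tuples) auto
  then show ?case using App.prems assms by (auto intro: fint_carrier)
qed

lemma tm_vals_tuples:
  assumes "is_structure L M" "assigns M v" "map (tm_sort L) ts = ss" "\<forall>t\<in>set ts. wf_tm L t"
  shows "map (tm_val M v) ts \<in> tuples M ss"
  using assms(4) by (intro map_tm_val_tuples[OF assms(3)] tm_val_carrier[OF assms(1,2)]) auto

lemma mdist_bounded:
  assumes "is_structure L M" "x \<in> carrier M s" "y \<in> carrier M s"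
  shows "\<bar>mdist M s x y\<bar> \<le> \<bar>diam_bound L s\<bar>"
proof -
  interpret Metric_space "carrier M s" "mdist M s" using assms(1) by (simp add: is_structure_def)
  have "mdist M s x y \<le> diam_bound L s" using assms unfolding is_structure_def by blast
  then show ?thesis using nonneg[of x y] by linarith
qed

lemma pint_bounded:
  assumes "is_structure L M" "p \<in> preds L" "xs \<in> tuples M (pdom L p)"
  shows "\<bar>pint M p xs\<bar> \<le> \<bar>plower L p\<bar> + \<bar>pupper L p\<bar>"
proof -
  have "pint M p xs \<in> {plower L p..pupper L p}" using assms unfolding is_structure_def by blast
  then show ?thesis by auto
qed

lemma carrier_nonempty: "is_structure L M \<Longrightarrow> carrier M s \<noteq> {}"
  unfolding is_structure_def by blast

lemma val_bounded:
  assumes M: "is_structure L M"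
  shows "affine_formula L \<phi> \<Longrightarrow> \<exists>K. \<forall>v. assigns M v \<longrightarrow> \<bar>val M v \<phi>\<bar> \<le> K"
proof (induction \<phi>)
  case (Dist s t u)
  then have tu: "wf_tm L t" "wf_tm L u" "tm_sort L t = s" "tm_sort L u = s" by auto
  have "\<bar>val M v (Dist s t u)\<bar> \<le> \<bar>diam_bound L s\<bar>" if "assigns M v" for v
    using tm_val_carrier[OF M that tu(1)] tm_val_carrier[OF M that tu(2)]
    unfolding val.simps tu by (rule mdist_bounded[OF M])
  then show ?case by blast
next
  case (Pred p ts)
  then show ?case
    using pint_bounded[OF M] tm_vals_tuples[OF M]
    by (auto intro!: exI[of _ "\<bar>plower L p\<bar> + \<bar>pupper L p\<bar>"])
next
  case (Const r)
  then show ?case by auto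
next
  case (Add \<phi> \<psi>)
  then obtain K K' where K: "assigns M v \<Longrightarrow> \<bar>val M v \<phi>\<bar> \<le> K" "assigns M v \<Longrightarrow> \<bar>val M v \<psi>\<bar> \<le> K'" for v
    by auto
  have "\<bar>val M v (Add \<phi> \<psi>)\<bar> \<le> K + K'" if "assigns M v" for v
    using K[OF that] by simp
  then show ?case by blast
next
  case (Scale r \<phi>)
  then obtain K where K: "assigns M v \<Longrightarrow> \<bar>val M v \<phi>\<bar> \<le> K" for v by auto
  have "\<bar>val M v (Scale r \<phi>)\<bar> \<le> \<bar>r\<bar> * K" if "assigns M v" for v
    using K[OF that] by (simp add: abs_mult mult_left_mono)
  then show ?case by blast
next
  case (QSup x \<phi>)
  then obtain K where K: "assigns M v \<Longrightarrow> \<bar>val M v \<phi>\<bar> \<le> K" for v by auto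
  have "\<bar>val M v (QSup x \<phi>)\<bar> \<le> K" if "assigns M v" for v
  proof -
    have "\<bar>val M (v(x := c)) \<phi>\<bar> \<le> K" if "c \<in> carrier M (fst x)" for c
      by (rule K[OF assigns_upd[OF \<open>assigns M v\<close> that]])
    then show ?thesis
      unfolding val.simps using carrier_nonempty[OF M] by (intro cSup_abs_le) auto
  qed
  then show ?case by blast
next
  case (QInf x \<phi>)
  then obtain K where K: "assigns M v \<Longrightarrow> \<bar>val M v \<phi>\<bar> \<le> K" for v by auto
  have "\<bar>val M v (QInf x \<phi>)\<bar> \<le> K" if "assigns M v" for v
  proof -
    have "\<bar>val M (v(x := c)) \<phi>\<bar> \<le> K" if "c \<in> carrier M (fst x)" for c
      by (rule K[OF assigns_upd[OF \<open>assigns M v\<close> that]])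
    then show ?thesis
      unfolding val.simps using carrier_nonempty[OF M] by (intro cInf_abs_ge) auto
  qed
  then show ?case by blast
qed

lemma val_bdd_above:
  assumes M: "is_structure L M" and "affine_formula L \<phi>" "assigns M v"
  shows "bdd_above ((\<lambda>c. val M (v(x := c)) \<phi>) ` carrier M (fst x))"
proof -
  obtain K where K: "assigns M v \<Longrightarrow> \<bar>val M v \<phi>\<bar> \<le> K" for v
    using val_bounded[OF assms(1,2)] by blast
  have *: "\<bar>val M (v(x := c)) \<phi>\<bar> \<le> K" if "c \<in> carrier M (fst x)" for c
    using K assigns_upd[OF assms(3) that] by blast
  show "bdd_above ((\<lambda>c. val M (v(x := c)) \<phi>) ` carrier M (fst x))"
    by (rule bdd_aboveI[of _ K]) (use * in \<open>auto simp: abs_le_iff\<close>)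
qed

subsection \<open>Substitution of variables\<close>

fun ren_tm :: "('s var \<Rightarrow> 's var) \<Rightarrow> ('s, 'f) tm \<Rightarrow> ('s, 'f) tm" where
  "ren_tm \<rho> (Var x) = Var (\<rho> x)"
| "ren_tm \<rho> (App f ts) = App f (map (ren_tm \<rho>) ts)"

lemma tm_val_ren: "tm_val M v (ren_tm \<rho> t) = tm_val M (v \<circ> \<rho>) t"
  by (induction t) (auto intro: arg_cong[of _ _ "fint M _"])

lemma tm_vars_ren: "tm_vars (ren_tm \<rho> t) = \<rho> ` tm_vars t"
  by (induction t) auto

lemma tm_sort_ren: "(\<And>x. fst (\<rho> x) = fst x) \<Longrightarrow> tm_sort L (ren_tm \<rho> t) = tm_sort L t"
  by (cases t) auto

lemma wf_tm_ren: "(\<And>x. fst (\<rho> x) = fst x) \<Longrightarrow> wf_tm L t \<Longrightarrow> wf_tm L (ren_tm \<rho> t)"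
  by (induction t) (auto simp: tm_sort_ren comp_def)

lemma exists_fresh_var:
  fixes s :: 's
  assumes "finite (X :: 's var set)"
  obtains n where "(s, n) \<notin> X"
proof -
  have "finite (snd ` X)" using assms by simp
  then obtain n where "n \<notin> snd ` X" using ex_new_if_finite[of "snd ` X"] by auto
  then show thesis by (intro that[of n]) force
qed

text \<open>The bound variable \<open>x\<close> is renamed to a fresh \<open>y\<close>, so that the substitution captures nothing. The
  assumption \<open>IH\<close> is the induction hypothesis of the next lemma, for which this is the common part of
  the two quantifier cases.\<close>

lemma rename_quantifier:
  fixes \<rho> :: "'s var \<Rightarrow> 's var" and \<phi> :: "('s, 'f, 'p) aform"
  assumes \<rho>: "\<And>x. fst (\<rho> x) = fst x"
    and IH: "\<And>\<rho>. (\<And>x. fst (\<rho> x) = fst x) \<Longrightarrow> \<exists>\<phi>'. affine_formula L \<phi>' \<and> free_vars \<phi>' \<subseteq> \<rho> ` free_vars \<phi> \<and>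
      (\<forall>(M :: ('s, 'f, 'p, 'a) struct) v. val M v \<phi>' = val M (v \<circ> \<rho>) \<phi>)"
  obtains y \<phi>' where "fst y = fst x" "affine_formula L \<phi>'"
    "free_vars \<phi>' - {y} \<subseteq> \<rho> ` (free_vars \<phi> - {x})"
    "\<And>(M :: ('s, 'f, 'p, 'a) struct) v c. val M (v(y := c)) \<phi>' = val M ((v \<circ> \<rho>)(x := c)) \<phi>"
proof -
  obtain n where n: "(fst x, n) \<notin> \<rho> ` free_vars \<phi>"
    by (rule exists_fresh_var[of "\<rho> ` free_vars \<phi>" "fst x"]) auto
  define y where "y = (fst x, n)"
  have y: "fst y = fst x" "y \<notin> \<rho> ` free_vars \<phi>" using n by (auto simp: y_def)
  have "\<And>z. fst ((\<rho>(x := y)) z) = fst z" using \<rho> y by simp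
  from IH[OF this] obtain \<phi>' where \<phi>': "affine_formula L \<phi>'" "free_vars \<phi>' \<subseteq> (\<rho>(x := y)) ` free_vars \<phi>"
    and v: "\<And>(M :: ('s, 'f, 'p, 'a) struct) v. val M v \<phi>' = val M (v \<circ> (\<rho>(x := y))) \<phi>" by blast
  show thesis
  proof (rule that[OF y(1) \<phi>'(1)])
    show "free_vars \<phi>' - {y} \<subseteq> \<rho> ` (free_vars \<phi> - {x})" using \<phi>'(2) by auto
    fix M :: "('s, 'f, 'p, 'a) struct" and v c
    show "val M (v(y := c)) \<phi>' = val M ((v \<circ> \<rho>)(x := c)) \<phi>"
      unfolding v using y(2) by (intro val_cong) auto
  qed
qed

lemma exists_rename:
  fixes \<rho> :: "'s var \<Rightarrow> 's var" and \<phi> :: "('s, 'f, 'p) aform"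
  assumes "affine_formula L \<phi>" "\<And>x. fst (\<rho> x) = fst x"
  shows "\<exists>\<phi>'. affine_formula L \<phi>' \<and> free_vars \<phi>' \<subseteq> \<rho> ` free_vars \<phi> \<and>
      (\<forall>(M :: ('s, 'f, 'p, 'a) struct) v. val M v \<phi>' = val M (v \<circ> \<rho>) \<phi>)"
  using assms
proof (induction \<phi> arbitrary: \<rho>)
  case (Dist s t u)
  then show ?case
    by (intro exI[of _ "Dist s (ren_tm \<rho> t) (ren_tm \<rho> u)"])
      (auto simp: tm_sort_ren wf_tm_ren tm_vars_ren tm_val_ren comp_def)
next
  case (Pred p ts)
  then show ?case
    by (intro exI[of _ "Pred p (map (ren_tm \<rho>) ts)"])
      (auto simp: tm_sort_ren wf_tm_ren tm_vars_ren tm_val_ren comp_def)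
next
  case (Const r)
  then show ?case by (intro exI[of _ "Const r"]) auto
next
  case (Add \<phi> \<psi>)
  obtain \<phi>' where 1: "affine_formula L \<phi>'" "free_vars \<phi>' \<subseteq> \<rho> ` free_vars \<phi>"
    "\<And>(M :: ('s, 'f, 'p, 'a) struct) v. val M v \<phi>' = val M (v \<circ> \<rho>) \<phi>"
    using Add.IH(1)[OF _ Add.prems(2)] Add.prems(1) unfolding affine_formula.simps by blast
  obtain \<psi>' where 2: "affine_formula L \<psi>'" "free_vars \<psi>' \<subseteq> \<rho> ` free_vars \<psi>"
    "\<And>(M :: ('s, 'f, 'p, 'a) struct) v. val M v \<psi>' = val M (v \<circ> \<rho>) \<psi>"
    using Add.IH(2)[OF _ Add.prems(2)] Add.prems(1) unfolding affine_formula.simps by blast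
  show ?case using 1 2 by (intro exI[of _ "Add \<phi>' \<psi>'"]) (auto simp: comp_def)
next
  case (Scale r \<phi>)
  obtain \<phi>' where 1: "affine_formula L \<phi>'" "free_vars \<phi>' \<subseteq> \<rho> ` free_vars \<phi>"
    "\<And>(M :: ('s, 'f, 'p, 'a) struct) v. val M v \<phi>' = val M (v \<circ> \<rho>) \<phi>"
    using Scale.IH[OF _ Scale.prems(2)] Scale.prems(1) unfolding affine_formula.simps by blast
  show ?case using 1 by (intro exI[of _ "Scale r \<phi>'"]) (auto simp: comp_def)
next
  case (QSup x \<phi>)
  have "affine_formula L \<phi>" using QSup.prems by simp
  obtain y \<phi>' where "fst y = fst x" "affine_formula L \<phi>'"
    "free_vars \<phi>' - {y} \<subseteq> \<rho> ` (free_vars \<phi> - {x})"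
    "\<And>(M :: ('s, 'f, 'p, 'a) struct) v c. val M (v(y := c)) \<phi>' = val M ((v \<circ> \<rho>)(x := c)) \<phi>"
    by (rule rename_quantifier[where x = x, OF QSup.prems(2) QSup.IH[OF \<open>affine_formula L \<phi>\<close>]]) (simp, rule that)
  then show ?case by (intro exI[of _ "QSup y \<phi>'"]) (auto simp: comp_def)
next
  case (QInf x \<phi>)
  have "affine_formula L \<phi>" using QInf.prems by simp
  obtain y \<phi>' where "fst y = fst x" "affine_formula L \<phi>'"
    "free_vars \<phi>' - {y} \<subseteq> \<rho> ` (free_vars \<phi> - {x})"
    "\<And>(M :: ('s, 'f, 'p, 'a) struct) v c. val M (v(y := c)) \<phi>' = val M ((v \<circ> \<rho>)(x := c)) \<phi>"
    by (rule rename_quantifier[where x = x, OF QInf.prems(2) QInf.IH[OF \<open>affine_formula L \<phi>\<close>]]) (simp, rule that)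
  then show ?case by (intro exI[of _ "QInf y \<phi>'"]) (auto simp: comp_def)
qed

subsection \<open>Blocks of quantifiers\<close>

lemma affine_formula_QSups [simp]: "affine_formula L (foldr QSup xs \<phi>) = affine_formula L \<phi>"
  by (induction xs) auto

lemma free_vars_QSups [simp]: "free_vars (foldr QSup xs \<phi>) = free_vars \<phi> - set xs"
  by (induction xs) auto

lemma val_le_QSups:
  assumes M: "is_structure L M" and \<phi>: "affine_formula L \<phi>" and "assigns M w"
  shows "assigns M v \<Longrightarrow> (\<And>x. x \<notin> set xs \<Longrightarrow> v x = w x) \<Longrightarrow> val M w \<phi> \<le> val M v (foldr QSup xs \<phi>)"
proof (induction xs arbitrary: v)
  case Nil
  then have "v = w" by auto
  then show ?case by simp
next
  case (Cons x xs)
  have w: "w x \<in> carrier M (fst x)" using assms(3) by (rule assignsD)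
  have "val M w \<phi> \<le> val M (v(x := w x)) (foldr QSup xs \<phi>)"
    using Cons.prems w by (intro Cons.IH assigns_upd) auto
  also have "\<dots> \<le> val M v (foldr QSup (x # xs) \<phi>)"
    using \<phi> Cons.prems(1) w by (auto intro!: cSUP_upper val_bdd_above[OF M])
  finally show ?case .
qed

lemma QSups_val_le:
  assumes M: "is_structure L M"
  shows "assigns M v \<Longrightarrow> (\<And>w. assigns M w \<Longrightarrow> (\<And>x. x \<notin> set xs \<Longrightarrow> w x = v x) \<Longrightarrow> val M w \<phi> \<le> K)
     \<Longrightarrow> val M v (foldr QSup xs \<phi>) \<le> K"
proof (induction xs arbitrary: v)
  case Nil
  then show ?case by simp
next
  case (Cons x xs)
  have "val M (v(x := c)) (foldr QSup xs \<phi>) \<le> K" if c: "c \<in> carrier M (fst x)" for c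
  proof (rule Cons.IH)
    show "assigns M (v(x := c))" using Cons.prems(1) c by (rule assigns_upd)
    fix w assume "assigns M w" "\<And>y. y \<notin> set xs \<Longrightarrow> w y = (v(x := c)) y"
    then show "val M w \<phi> \<le> K" by (intro Cons.prems(2)) auto
  qed
  then show ?case using carrier_nonempty[OF M] by (auto intro!: cSUP_least)
qed

section \<open>An averaging mean on the self-maps of a structure\<close>

text \<open>The set \<open>B\<close> does not occur here, because the whole of \<open>M\<close> will be copied and a copy of \<open>M\<close>
  restricts to a copy of each of its subsets.\<close>

locale affine_pair =
  fixes L :: "('s, 'f, 'p) lang" and M :: "('s, 'f, 'p, 'a) struct" and A :: "'s \<Rightarrow> 'a set"
    and J :: "'j set" and sr :: "'j \<Rightarrow> 's" and a b :: "'j \<Rightarrow> 'a"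
  assumes str: "is_structure L M"
    and A: "A s \<subseteq> carrier M s"
    and a: "j \<in> J \<Longrightarrow> a j \<in> carrier M (sr j)"
    and b: "j \<in> J \<Longrightarrow> b j \<in> carrier M (sr j)"
    and equiv: "aff_equiv L M A J sr a b"
begin

text \<open>Every function \<open>i\<close> is read as a family of maps of the sorts of \<open>M\<close> into themselves which fix \<open>A\<close>
  pointwise: values which would violate this are overridden. Thus the index type is a full function
  type and \<open>snd\<close> is the identity map.\<close>

definition move :: "('s \<times> 'a \<Rightarrow> 'a) \<Rightarrow> 's \<Rightarrow> 'a \<Rightarrow> 'a" where
  "move i s m = (if m \<notin> A s \<and> i (s, m) \<in> carrier M s then i (s, m) else m)"

lemma move_carrier: "m \<in> carrier M s \<Longrightarrow> move i s m \<in> carrier M s"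
  unfolding move_def by simp

lemma move_A: "m \<in> A s \<Longrightarrow> move i s m = m"
  unfolding move_def by simp

lemma move_snd [simp]: "move snd s m = m"
  unfolding move_def by simp

text \<open>A variable of a formula stands for an \<open>item\<close>: an element of \<open>M\<close>, subject to the map \<open>i\<close>, or an
  index in \<open>J\<close>, standing for the corresponding entry of the tuple \<open>c\<close> (which will be \<open>a\<close> or \<open>b\<close>).\<close>

fun eval_item :: "('j \<Rightarrow> 'a) \<Rightarrow> ('s \<times> 'a \<Rightarrow> 'a) \<Rightarrow> ('s \<times> 'a) + 'j \<Rightarrow> 'a" where
  "eval_item c i (Inl (s, m)) = move i s m"
| "eval_item c i (Inr j) = c j"

lemma item_cases:
  obtains (elem) s m where "q = Inl (s, m)" | (index) j where "(q :: ('s \<times> 'a) + 'j) = Inr j"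
  by (cases q) auto

fun item_of :: "'s \<Rightarrow> ('s \<times> 'a) + 'j \<Rightarrow> bool" where
  "item_of s (Inl (t, m)) \<longleftrightarrow> t = s \<and> m \<in> carrier M s"
| "item_of s (Inr j) \<longleftrightarrow> j \<in> J \<and> sr j = s"

definition itemized :: "('s var \<Rightarrow> ('s \<times> 'a) + 'j) \<Rightarrow> bool" where
  "itemized \<rho> \<longleftrightarrow> (\<forall>x. item_of (fst x) (\<rho> x))"

lemma assigns_eval:
  assumes "itemized \<rho>" "\<And>j. j \<in> J \<Longrightarrow> c j \<in> carrier M (sr j)"
  shows "assigns M (eval_item c i \<circ> \<rho>)"
  unfolding assigns_def
proof
  fix x
  have "item_of (fst x) (\<rho> x)" using assms(1) by (simp add: itemized_def del: split_paired_All)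
  then show "(eval_item c i \<circ> \<rho>) x \<in> carrier M (fst x)"
    by (cases "\<rho> x" rule: item_cases) (auto intro: move_carrier dest: assms(2))
qed

text \<open>The two formulas are given disjoint sets of variables, those with even and those with odd index.
  The property \<open>Q\<close> carries over whatever was required of both assignments of items.\<close>

lemma merge_formulas:
  fixes \<rho>1 \<rho>2 :: "'s var \<Rightarrow> 'q"
  assumes "affine_formula L \<phi>1" "affine_formula L \<phi>2"
    and "\<And>x. Q (fst x) (\<rho>1 x)" "\<And>x. Q (fst x) (\<rho>2 x)"
  obtains \<phi> \<rho> where "affine_formula L \<phi>" "\<And>x. Q (fst x) (\<rho> x)"
    "\<And>e. val M (e \<circ> \<rho>) \<phi> = val M (e \<circ> \<rho>1) \<phi>1 + val M (e \<circ> \<rho>2) \<phi>2"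
proof -
  define \<rho> where "\<rho> x = (if even (snd x) then \<rho>1 else \<rho>2) (fst x, snd x div 2)" for x
  obtain \<phi>1' where 1: "affine_formula L \<phi>1'"
    "\<And>v. val M v \<phi>1' = val M (v \<circ> (\<lambda>x. (fst x, 2 * snd x))) \<phi>1"
    using exists_rename[OF assms(1), of "\<lambda>x. (fst x, 2 * snd x)"] by auto
  obtain \<phi>2' where 2: "affine_formula L \<phi>2'"
    "\<And>v. val M v \<phi>2' = val M (v \<circ> (\<lambda>x. (fst x, 2 * snd x + 1))) \<phi>2"
    using exists_rename[OF assms(2), of "\<lambda>x. (fst x, 2 * snd x + 1)"] by auto
  show thesis
  proof (rule that[of "Add \<phi>1' \<phi>2'" \<rho>])
    show "affine_formula L (Add \<phi>1' \<phi>2')" using 1 2 by simp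
    show "Q (fst x) (\<rho> x)" for x
      using assms(3)[of "(fst x, snd x div 2)"] assms(4)[of "(fst x, snd x div 2)"] by (simp add: \<rho>_def)
    have "e \<circ> \<rho> \<circ> (\<lambda>x. (fst x, 2 * snd x)) = e \<circ> \<rho>1" "e \<circ> \<rho> \<circ> (\<lambda>x. (fst x, 2 * snd x + 1)) = e \<circ> \<rho>2" for e :: "'q \<Rightarrow> 'a"
      by (auto simp: fun_eq_iff \<rho>_def)
    then show "val M (e \<circ> \<rho>) (Add \<phi>1' \<phi>2') = val M (e \<circ> \<rho>1) \<phi>1 + val M (e \<circ> \<rho>2) \<phi>2" for e :: "'q \<Rightarrow> 'a"
      by (simp only: val.simps 1 2)
  qed
qed

text \<open>The maps \<open>i\<close> move the elements outside \<open>A\<close> independently and arbitrarily. So \<open>\<theta>\<close> is bounded by \<open>K\<close>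
  for all \<open>i\<close> if and only if its supremum over the variables which stand for such elements is at most
  \<open>K\<close>. This supremum is an affine formula in \<open>a\<close> with parameters in \<open>A\<close>, and has the same value at \<open>b\<close>.\<close>

lemma upper_bound_transfers:
  assumes \<theta>: "affine_formula L \<theta>" and \<rho>: "itemized \<rho>"
    and K: "\<And>i. val M (eval_item a i \<circ> \<rho>) \<theta> \<le> K"
  shows "val M (eval_item b i \<circ> \<rho>) \<theta> \<le> K"
proof -
  \<comment> \<open>Variables which stand for the same item are identified; otherwise the supremum would move
    several copies of one element independently.\<close>
  define r where "r x = (if x \<in> free_vars \<theta> then SOME y. y \<in> free_vars \<theta> \<and> \<rho> y = \<rho> x else x)" for x
  have r: "r x \<in> free_vars \<theta>" "\<rho> (r x) = \<rho> x" if "x \<in> free_vars \<theta>" for x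
    using someI[of "\<lambda>y. y \<in> free_vars \<theta> \<and> \<rho> y = \<rho> x" x] that by (auto simp: r_def)
  have sort_unique: "s = t" if "item_of s q" "item_of t q" for s t q
    using that by (cases q rule: item_cases) auto
  have it: "item_of (fst x) (\<rho> x)" for x using \<rho> by (simp add: itemized_def del: split_paired_All)
  have "fst (r x) = fst x" for x
  proof (cases "x \<in> free_vars \<theta>")
    case True
    then show ?thesis using r(2)[OF True] it[of x] it[of "r x"] by (auto intro: sort_unique)
  qed (simp add: r_def)
  from exists_rename[OF \<theta> this] obtain \<theta>' where \<theta>': "affine_formula L \<theta>'"
    and fv: "free_vars \<theta>' \<subseteq> r ` free_vars \<theta>" and val_\<theta>': "\<And>v. val M v \<theta>' = val M (v \<circ> r) \<theta>" by blast
  have val_eq: "val M (e \<circ> \<rho>) \<theta>' = val M (e \<circ> \<rho>) \<theta>" for e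
    unfolding val_\<theta>' by (rule val_cong) (simp add: r)
  have inj: "x = y" if x: "x \<in> free_vars \<theta>'" and y: "y \<in> free_vars \<theta>'" and "\<rho> x = \<rho> y" for x y
  proof -
    obtain x' y' where xy': "x' \<in> free_vars \<theta>" "x = r x'" "y' \<in> free_vars \<theta>" "y = r y'"
      using subsetD[OF fv x] subsetD[OF fv y] by blast
    then have "\<rho> x' = \<rho> y'" using \<open>\<rho> x = \<rho> y\<close> r by metis
    then show ?thesis using xy' by (simp add: r_def)
  qed
  define X where "X = {x \<in> free_vars \<theta>'. \<exists>s m. \<rho> x = Inl (s, m) \<and> m \<notin> A s}"
  have "finite X" unfolding X_def by simp
  then obtain xs where xs: "set xs = X" using finite_list by blast
  have off_X: "eval_item c i (\<rho> x) = eval_item c i' (\<rho> x)" if "x \<in> free_vars \<theta>'" "x \<notin> X" for c i i' x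
    using that by (cases "\<rho> x" rule: item_cases) (auto simp: X_def move_A)
  have "val M (eval_item a snd \<circ> \<rho>) (foldr QSup xs \<theta>') \<le> K"
  proof (rule QSups_val_le[OF str assigns_eval[OF \<rho> a]])
    fix w assume w: "assigns M w" "\<And>x. x \<notin> set xs \<Longrightarrow> w x = (eval_item a snd \<circ> \<rho>) x"
    \<comment> \<open>The assignment \<open>w\<close> of the quantified variables is induced by a map \<open>i\<close>.\<close>
    define i where "i p = w (SOME x. x \<in> X \<and> \<rho> x = Inl p)" for p
    have "w x = (eval_item a i \<circ> \<rho>) x" if x: "x \<in> free_vars \<theta>'" for x
    proof (cases "x \<in> X")
      case True
      then obtain s m where sm: "\<rho> x = Inl (s, m)" "m \<notin> A s" unfolding X_def by blast
      have "(SOME y. y \<in> X \<and> \<rho> y = Inl (s, m)) = x"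
        by (rule some_equality) (use True sm inj in \<open>auto simp: X_def\<close>)
      then have "i (s, m) = w x" by (simp add: i_def)
      moreover have "w x \<in> carrier M s" using assignsD[OF w(1), of x] it[of x] sm by simp
      ultimately show ?thesis using sm by (simp add: move_def)
    next
      case False
      then show ?thesis using w(2)[of x] off_X[OF x False, of a snd i] xs by simp
    qed
    then have "val M w \<theta>' = val M (eval_item a i \<circ> \<rho>) \<theta>'" by (rule val_cong)
    then show "val M w \<theta>' \<le> K" using K val_eq by simp
  qed
  also have "val M (eval_item a snd \<circ> \<rho>) (foldr QSup xs \<theta>') = val M (eval_item b snd \<circ> \<rho>) (foldr QSup xs \<theta>')"
  proof -
    have "(eval_item a snd (\<rho> x) = eval_item b snd (\<rho> x) \<and> eval_item a snd (\<rho> x) \<in> A (fst x)) \<or>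
       (\<exists>j\<in>J. sr j = fst x \<and> eval_item a snd (\<rho> x) = a j \<and> eval_item b snd (\<rho> x) = b j)"
      if "x \<in> free_vars (foldr QSup xs \<theta>')" for x
      using that it[of x] xs by (cases "\<rho> x" rule: item_cases) (auto simp: X_def)
    then show ?thesis using equiv \<theta>' unfolding aff_equiv_def by (simp add: comp_def)
  qed
  finally have 1: "val M (eval_item b snd \<circ> \<rho>) (foldr QSup xs \<theta>') \<le> K" .
  define w where "w x = (if x \<in> X then eval_item b i (\<rho> x) else eval_item b snd (\<rho> x))" for x
  have "assigns M w"
    using assigns_eval[OF \<rho> b, of i] assigns_eval[OF \<rho> b, of snd] by (simp add: assigns_def w_def del: split_paired_All)
  then have "val M w \<theta>' \<le> val M (eval_item b snd \<circ> \<rho>) (foldr QSup xs \<theta>')"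
    using xs by (intro val_le_QSups[OF str \<theta>'] assigns_eval \<rho> b) (auto simp: w_def)
  moreover have "val M w \<theta>' = val M (eval_item b i \<circ> \<rho>) \<theta>'"
    by (rule val_cong) (use off_X in \<open>auto simp: w_def\<close>)
  ultimately show ?thesis using 1 val_eq by simp
qed

definition of_M :: "('s var \<Rightarrow> ('s \<times> 'a) + 'j) \<Rightarrow> bool" where
  "of_M \<rho> \<longleftrightarrow> (\<forall>x. item_of (fst x) (\<rho> x) \<and> isl (\<rho> x))"

lemma of_M_itemized: "of_M \<rho> \<Longrightarrow> itemized \<rho>"
  unfolding of_M_def itemized_def by blast

lemma eval_item_of_M: "of_M \<rho> \<Longrightarrow> eval_item c i \<circ> \<rho> = eval_item d i \<circ> \<rho>"
proof
  fix x assume "of_M \<rho>"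
  then have "isl (\<rho> x)" unfolding of_M_def by blast
  then show "(eval_item c i \<circ> \<rho>) x = (eval_item d i \<circ> \<rho>) x"
    by (cases "\<rho> x" rule: item_cases) auto
qed

lemma exists_of_M: "\<exists>\<rho>. of_M \<rho>"
proof -
  have "\<forall>s. \<exists>m. m \<in> carrier M s" using carrier_nonempty[OF str] by blast
  then obtain m where "\<And>s. m s \<in> carrier M s" by metis
  then have "of_M (\<lambda>x. Inl (fst x, m (fst x)))" unfolding of_M_def by simp
  then show ?thesis by blast
qed

lemma bfun_val_eval:
  assumes "affine_formula L \<phi>" "itemized \<rho>" "\<And>j. j \<in> J \<Longrightarrow> c j \<in> carrier M (sr j)"
  shows "bfun (\<lambda>i. val M (eval_item c i \<circ> \<rho>) \<phi>)"
  using val_bounded[OF str assms(1)] assigns_eval[OF assms(2,3)] unfolding bfun_def by blast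

text \<open>The heart of the matter. Write \<open>P i = \<phi>(i) - \<phi>(id) + e\<close> and suppose that
  \<open>\<psi>(i, a) + P i \<le> \<psi>(i, b)\<close> for all maps \<open>i\<close>. If \<open>\<psi>(i, a) + k P i \<le> K\<close> for all \<open>i\<close>, then the same bound
  holds with \<open>b\<close> in place of \<open>a\<close>, and hence \<open>\<psi>(i, a) + (k + 1) P i \<le> K\<close> for all \<open>i\<close>. By induction the
  bound holds for all \<open>k\<close>, which is absurd at the identity map, where \<open>P\<close> has the value \<open>e > 0\<close>.\<close>

lemma no_uniform_gap:
  assumes \<phi>: "affine_formula L \<phi>" "of_M \<rho>" and \<psi>: "affine_formula L \<psi>" "itemized \<sigma>" and "0 < e"
  shows "\<exists>i. - e < val M (eval_item a i \<circ> \<rho>) \<phi> - val M (eval_item a snd \<circ> \<rho>) \<phi>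
     + (val M (eval_item a i \<circ> \<sigma>) \<psi> - val M (eval_item b i \<circ> \<sigma>) \<psi>)"
proof (rule ccontr)
  define c where "c = val M (eval_item a snd \<circ> \<rho>) \<phi> - e"
  define P where "P i = val M (eval_item a i \<circ> \<rho>) \<phi> - c" for i
  define Q where "Q d i = val M (eval_item d i \<circ> \<sigma>) \<psi>" for d i
  assume "\<not> ?thesis"
  then have gap: "Q a i + P i \<le> Q b i" for i
    unfolding not_ex not_less by (auto simp: P_def Q_def c_def dest!: spec[of _ i])
  obtain K where K: "\<And>i. Q a i \<le> K" "- K \<le> Q a snd"
    using bfunE[OF bfun_val_eval[OF \<psi> a]] unfolding Q_def by (metis abs_le_iff minus_le_iff)
  have bound: "Q a i + real k * P i \<le> K" for k i
  proof (induction k arbitrary: i)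
    case 0
    then show ?case using K by simp
  next
    case (Suc k)
    obtain \<theta> \<tau> where \<theta>: "affine_formula L \<theta>" and \<tau>: "\<And>x. item_of (fst x) (\<tau> x)"
      and v: "\<And>e. val M (e \<circ> \<tau>) \<theta> = val M (e \<circ> \<sigma>) \<psi> + val M (e \<circ> \<rho>) (Scale (real k) (Add \<phi> (Const (- c))))"
      using \<phi> \<psi> by (rule_tac merge_formulas[of \<psi> "Scale (real k) (Add \<phi> (Const (- c)))" item_of \<sigma> \<rho>])
          (auto simp: of_M_def itemized_def simp del: split_paired_All)
    have va: "val M (eval_item d i \<circ> \<tau>) \<theta> = Q d i + real k * P i" for d i
      unfolding v Q_def P_def by (simp add: eval_item_of_M[OF \<phi>(2), of a i d])
    have "itemized \<tau>" using \<tau> by (simp add: itemized_def del: split_paired_All)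
    from upper_bound_transfers[OF \<theta> this, of K i] Suc.IH have "Q b i + real k * P i \<le> K"
      by (simp add: va)
    then show ?case using gap[of i] by (simp add: algebra_simps)
  qed
  have "P snd = e" by (simp add: P_def c_def)
  obtain k where "2 * K < real k * e" using ex_less_of_nat_mult[OF \<open>0 < e\<close>] by blast
  then show False using bound[of snd k] K(2) \<open>P snd = e\<close> by simp
qed

text \<open>The two families of linear conditions on \<open>\<Lambda>\<close> say that \<open>\<Lambda>\<close> vanishes on the subspace \<open>V\<close> of the
  functions considered in the preceding lemma.\<close>

theorem exists_averaging_mean:
  obtains \<Lambda> where "mean \<Lambda>"
    "\<And>\<phi> \<rho>. affine_formula L \<phi> \<Longrightarrow> of_M \<rho> \<Longrightarrow>
       \<Lambda> (\<lambda>i. val M (eval_item a i \<circ> \<rho>) \<phi>) = val M (eval_item a snd \<circ> \<rho>) \<phi>"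
    "\<And>\<psi> \<sigma>. affine_formula L \<psi> \<Longrightarrow> itemized \<sigma> \<Longrightarrow>
       \<Lambda> (\<lambda>i. val M (eval_item a i \<circ> \<sigma>) \<psi>) = \<Lambda> (\<lambda>i. val M (eval_item b i \<circ> \<sigma>) \<psi>)"
proof -
  let ?g = "\<lambda>\<phi> \<rho> \<psi> \<sigma> i. val M (eval_item a i \<circ> \<rho>) \<phi> - val M (eval_item a snd \<circ> \<rho>) \<phi>
     + (val M (eval_item a i \<circ> \<sigma>) \<psi> - val M (eval_item b i \<circ> \<sigma>) \<psi>)"
  define V where "V = {g. \<exists>\<phi> \<rho> \<psi> \<sigma>. affine_formula L \<phi> \<and> of_M \<rho> \<and> affine_formula L \<psi> \<and> itemized \<sigma>
      \<and> g = ?g \<phi> \<rho> \<psi> \<sigma>}"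
  have V: "?g \<phi> \<rho> \<psi> \<sigma> \<in> V"
    if "affine_formula L \<phi>" "of_M \<rho>" "affine_formula L \<psi>" "itemized \<sigma>" for \<phi> \<rho> \<psi> \<sigma>
    using that unfolding V_def by blast
  obtain \<rho>0 where \<rho>0: "of_M \<rho>0" using exists_of_M by blast
  have "bounded_subspace V"
    unfolding bounded_subspace_def
  proof (intro conjI ballI allI)
    show "(\<lambda>i. 0) \<in> V"
      using V[of "Const 0" \<rho>0 "Const 0" \<rho>0] \<rho>0 of_M_itemized by simp
    fix f assume "f \<in> V"
    then obtain \<phi> \<rho> \<psi> \<sigma> where f: "affine_formula L \<phi>" "of_M \<rho>" "affine_formula L \<psi>" "itemized \<sigma>"
      "f = ?g \<phi> \<rho> \<psi> \<sigma>" unfolding V_def by blast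
    show "bfun f"
      unfolding f(5) by (intro bfun_add bfun_diff bfun_val_eval bfun_const f of_M_itemized a b)
    show "(\<lambda>i. c * f i) \<in> V" for c
      using V[of "Scale c \<phi>" \<rho> "Scale c \<psi>" \<sigma>] f by (simp add: algebra_simps)
    fix f' assume "f' \<in> V"
    then obtain \<phi>' \<rho>' \<psi>' \<sigma>' where f': "affine_formula L \<phi>'" "of_M \<rho>'" "affine_formula L \<psi>'" "itemized \<sigma>'"
      "f' = ?g \<phi>' \<rho>' \<psi>' \<sigma>'" unfolding V_def by blast
    obtain \<phi>'' \<rho>'' where 1: "affine_formula L \<phi>''" "\<And>x. item_of (fst x) (\<rho>'' x) \<and> isl (\<rho>'' x)"
      "\<And>e. val M (e \<circ> \<rho>'') \<phi>'' = val M (e \<circ> \<rho>) \<phi> + val M (e \<circ> \<rho>') \<phi>'"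
      using f f' by (rule_tac merge_formulas[of \<phi> \<phi>' "\<lambda>s q. item_of s q \<and> isl q" \<rho> \<rho>'])
          (auto simp: of_M_def simp del: split_paired_All)
    obtain \<psi>'' \<sigma>'' where 2: "affine_formula L \<psi>''" "\<And>x. item_of (fst x) (\<sigma>'' x)"
      "\<And>e. val M (e \<circ> \<sigma>'') \<psi>'' = val M (e \<circ> \<sigma>) \<psi> + val M (e \<circ> \<sigma>') \<psi>'"
      using f f' by (rule_tac merge_formulas[of \<psi> \<psi>' item_of \<sigma> \<sigma>'])
          (auto simp: itemized_def simp del: split_paired_All)
    have "?g \<phi>'' \<rho>'' \<psi>'' \<sigma>'' \<in> V"
      using 1 2 by (intro V) (auto simp: of_M_def itemized_def simp del: split_paired_All)
    also have "?g \<phi>'' \<rho>'' \<psi>'' \<sigma>'' = (\<lambda>i. f i + f' i)"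
      by (auto simp: 1 2 f f' fun_eq_iff)
    finally show "(\<lambda>i. f i + f' i) \<in> V" .
  qed
  moreover have "sup_nonneg V"
    unfolding sup_nonneg_def V_def using no_uniform_gap by blast
  ultimately obtain \<Lambda> where \<Lambda>: "mean \<Lambda>" "\<And>g. g \<in> V \<Longrightarrow> \<Lambda> g = 0"
    by (rule exists_mean_vanishing_on) blast
  interpret mean \<Lambda> by fact
  show thesis
  proof (rule that[OF \<Lambda>(1)])
    fix \<phi> \<rho> assume \<phi>: "affine_formula L \<phi>" "of_M \<rho>"
    have "\<Lambda> (\<lambda>i. val M (eval_item a i \<circ> \<rho>) \<phi> - val M (eval_item a snd \<circ> \<rho>) \<phi>) = 0"
      using \<Lambda>(2)[OF V[of \<phi> \<rho> "Const 0" \<rho>]] \<phi> of_M_itemized by simp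
    then show "\<Lambda> (\<lambda>i. val M (eval_item a i \<circ> \<rho>) \<phi>) = val M (eval_item a snd \<circ> \<rho>) \<phi>"
      using diff[OF bfun_val_eval[OF \<phi>(1) of_M_itemized[OF \<phi>(2)] a] bfun_const] by simp
  next
    fix \<psi> \<sigma> assume \<psi>: "affine_formula L \<psi>" "itemized \<sigma>"
    have "\<Lambda> (\<lambda>i. val M (eval_item a i \<circ> \<sigma>) \<psi> - val M (eval_item b i \<circ> \<sigma>) \<psi>) = 0"
      using \<Lambda>(2)[OF V[of "Const 0" \<rho>0 \<psi> \<sigma>]] \<psi> \<rho>0 by simp
    then show "\<Lambda> (\<lambda>i. val M (eval_item a i \<circ> \<sigma>) \<psi>) = \<Lambda> (\<lambda>i. val M (eval_item b i \<circ> \<sigma>) \<psi>)"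
      using diff[OF bfun_val_eval[OF \<psi> a] bfun_val_eval[OF \<psi> b]] by simp
  qed
qed

end

section \<open>The power of a structure by a mean\<close>

lemma tuple_dists_nth:
  assumes "length xs = length ss" "length ys = length ss"
  shows "tuple_dists M ss xs ys = map (\<lambda>k. mdist M (ss ! k) (xs ! k) (ys ! k)) [0..<length ss]"
  unfolding tuple_dists_def using assms by (intro nth_equalityI) auto

lemma concave_modulus_zero: "concave_modulus n \<Delta> \<Longrightarrow> \<Delta> (map (\<lambda>k. 0) [0..<n]) = 0"
  by (simp add: concave_modulus_def map_replicate_const)

lemma val_QInf: "val M v (QInf x \<phi>) = - val M v (QSup x (Scale (- 1) \<phi>))"
  by (simp add: Inf_real_def image_image)

text \<open>The elements are the families \<open>X n i\<close> of elements of \<open>M\<close>, two of them being identified if the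
  mean of their pointwise distance is \<open>0\<close>; each class has a chosen representative. It is a direct
  integral of copies of \<open>M\<close>, for a finitely additive measure.\<close>

locale mean_power = ultra_mean F \<Lambda>
  for F :: "nat filter" and \<Lambda> :: "('i \<Rightarrow> real) \<Rightarrow> real" +
  fixes L :: "('s, 'f, 'p) lang" and M :: "('s, 'f, 'p, 'a) struct"
  assumes lang: "language L" and str: "is_structure L M"
begin

definition families :: "'s \<Rightarrow> (nat \<Rightarrow> 'i \<Rightarrow> 'a) set" where
  "families s = {X. \<forall>n i. X n i \<in> carrier M s}"

definition slice :: "'s \<Rightarrow> (nat \<Rightarrow> 'i \<Rightarrow> 'a) \<Rightarrow> (nat \<Rightarrow> 'i \<Rightarrow> 'a) \<Rightarrow> nat \<times> 'i \<Rightarrow> real" where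
  "slice s X Y k = mdist M s (X (fst k) (snd k)) (Y (fst k) (snd k))"

text \<open>Outside the families the mean might not be defined, but distances must be nonnegative on the
  whole type.\<close>

definition pdist :: "'s \<Rightarrow> (nat \<Rightarrow> 'i \<Rightarrow> 'a) \<Rightarrow> (nat \<Rightarrow> 'i \<Rightarrow> 'a) \<Rightarrow> real" where
  "pdist s X Y = (if X \<in> families s \<and> Y \<in> families s then umean (slice s X Y) else 0)"

lemma familiesD: "X \<in> families s \<Longrightarrow> X n i \<in> carrier M s"
  unfolding families_def by blast

lemma familiesI: "(\<And>n i. X n i \<in> carrier M s) \<Longrightarrow> X \<in> families s"
  unfolding families_def by blast

lemma metric: "Metric_space (carrier M s) (mdist M s)"
  using str unfolding is_structure_def by blast

lemma mdist_nonneg [simp]: "0 \<le> mdist M s x y"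
  using metric by (rule Metric_space.nonneg)

lemma bfun_slice: assumes "X \<in> families s" "Y \<in> families s" shows "bfun (slice s X Y)"
proof (rule bfunI)
  show "\<bar>slice s X Y k\<bar> \<le> \<bar>diam_bound L s\<bar>" for k
    unfolding slice_def by (intro mdist_bounded[OF str] familiesD[OF assms(1)] familiesD[OF assms(2)])
qed

lemma pdist_eq: "X \<in> families s \<Longrightarrow> Y \<in> families s \<Longrightarrow> pdist s X Y = umean (slice s X Y)"
  by (simp add: pdist_def)

lemma pdist_nonneg: "0 \<le> pdist s X Y"
  unfolding pdist_def by (auto intro!: nonneg bfun_slice simp: slice_def)

lemma pdist_commute: "pdist s X Y = pdist s Y X"
proof -
  have "slice s X Y = slice s Y X"
    unfolding slice_def using metric by (intro ext Metric_space.commute)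
  then show ?thesis by (auto simp: pdist_def)
qed

lemma pdist_self: "pdist s X X = 0"
proof (cases "X \<in> families s")
  case True
  then have "slice s X X = (\<lambda>k. 0)"
    using Metric_space.zero[OF metric] familiesD[OF True] by (simp add: slice_def fun_eq_iff)
  then show ?thesis using True by (simp add: pdist_eq)
qed (simp add: pdist_def)

lemma pdist_triangle:
  assumes "X \<in> families s" "Y \<in> families s" "Z \<in> families s"
  shows "pdist s X Z \<le> pdist s X Y + pdist s Y Z"
proof -
  have "umean (slice s X Z) \<le> umean (\<lambda>k. slice s X Y k + slice s Y Z k)"
    unfolding slice_def[abs_def]
    by (intro mono bfun_add bfun_slice[unfolded slice_def[abs_def]] assms Metric_space.triangle[OF metric] assms[THEN familiesD])
  also have "\<dots> = umean (slice s X Y) + umean (slice s Y Z)"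
    by (intro add bfun_slice assms)
  finally show ?thesis using assms by (simp add: pdist_eq)
qed

lemma pdist_cong:
  assumes "X \<in> families s" "Y \<in> families s" "X' \<in> families s" "Y' \<in> families s"
    "pdist s X X' = 0" "pdist s Y Y' = 0"
  shows "pdist s X Y = pdist s X' Y'"
  using pdist_triangle[of X s X' Y] pdist_triangle[of X' s Y' Y]
    pdist_triangle[of X' s X Y'] pdist_triangle[of X s Y Y']
    pdist_commute[of s X' X] pdist_commute[of s Y' Y] assms
  by linarith

definition rep :: "'s \<Rightarrow> (nat \<Rightarrow> 'i \<Rightarrow> 'a) \<Rightarrow> (nat \<Rightarrow> 'i \<Rightarrow> 'a)" where
  "rep s X = (SOME Y. Y \<in> families s \<and> pdist s X Y = 0)"

lemma rep: assumes "X \<in> families s" shows "rep s X \<in> families s" "pdist s X (rep s X) = 0"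
  using someI[of "\<lambda>Y. Y \<in> families s \<and> pdist s X Y = 0" X] assms pdist_self
  unfolding rep_def by auto

lemma rep_eq:
  assumes "X \<in> families s" "Y \<in> families s" "pdist s X Y = 0"
  shows "rep s X = rep s Y"
proof -
  have "pdist s X Z = pdist s Y Z" if "Z \<in> families s" for Z
    using assms that by (intro pdist_cong) (auto simp: pdist_self)
  then have "(\<lambda>Z. Z \<in> families s \<and> pdist s X Z = 0) = (\<lambda>Z. Z \<in> families s \<and> pdist s Y Z = 0)"
    by auto
  then show ?thesis unfolding rep_def by simp
qed

definition fpower :: "'f \<Rightarrow> (nat \<Rightarrow> 'i \<Rightarrow> 'a) list \<Rightarrow> nat \<Rightarrow> 'i \<Rightarrow> 'a" where
  "fpower f Xs n i = fint M f (map (\<lambda>X. X n i) Xs)"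

definition ppower :: "'p \<Rightarrow> (nat \<Rightarrow> 'i \<Rightarrow> 'a) list \<Rightarrow> nat \<times> 'i \<Rightarrow> real" where
  "ppower p Xs k = pint M p (map (\<lambda>X. X (fst k) (snd k)) Xs)"

definition power :: "('s, 'f, 'p, nat \<Rightarrow> 'i \<Rightarrow> 'a) struct" where
  "power = \<lparr>carrier = \<lambda>s. rep s ` families s, mdist = pdist,
     fint = \<lambda>f Xs. rep (fcod L f) (fpower f Xs), pint = \<lambda>p Xs. umean (ppower p Xs)\<rparr>"

lemma power_sel [simp]:
  "carrier power s = rep s ` families s" "mdist power = pdist"
  "fint power f Xs = rep (fcod L f) (fpower f Xs)" "pint power p Xs = umean (ppower p Xs)"
  unfolding power_def by simp_all

definition ftuples :: "'s list \<Rightarrow> (nat \<Rightarrow> 'i \<Rightarrow> 'a) list set" where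
  "ftuples ss = {Xs. length Xs = length ss \<and> (\<forall>k<length ss. Xs ! k \<in> families (ss ! k))}"

lemma carrier_power_families: "X \<in> carrier power s \<Longrightarrow> X \<in> families s"
  using rep(1) by auto

lemma tuples_power: "Xs \<in> tuples power ss \<Longrightarrow> Xs \<in> ftuples ss"
  using tuplesD[of Xs power ss] carrier_power_families unfolding ftuples_def by blast

lemma ftuples_tuples: "Xs \<in> ftuples ss \<Longrightarrow> map (\<lambda>X. X n i) Xs \<in> tuples M ss"
  unfolding ftuples_def using familiesD[of "Xs ! k" "ss ! k" n i for k]
  by (intro mem_tuplesI) auto

lemma fpower_families: "f \<in> funs L \<Longrightarrow> Xs \<in> ftuples (fdom L f) \<Longrightarrow> fpower f Xs \<in> families (fcod L f)"
  unfolding fpower_def[abs_def] by (intro familiesI fint_carrier[OF str] ftuples_tuples)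

lemma bfun_ppower: assumes "p \<in> preds L" "Xs \<in> ftuples (pdom L p)" shows "bfun (ppower p Xs)"
proof (rule bfunI)
  show "\<bar>ppower p Xs k\<bar> \<le> \<bar>plower L p\<bar> + \<bar>pupper L p\<bar>" for k
    unfolding ppower_def by (intro pint_bounded[OF str] ftuples_tuples assms)
qed

text \<open>Jensen's inequality is what lets the moduli of uniform continuity of \<open>M\<close> hold for mean distances;
  this is where their concavity is needed.\<close>

lemma modulus_umean:
  assumes \<Delta>: "concave_modulus (length ss) \<Delta>" and X: "Xs \<in> ftuples ss" "Ys \<in> ftuples ss"
    and g: "bfun g" "\<And>k. g k \<le> \<Delta> (tuple_dists M ss (map (\<lambda>X. X (fst k) (snd k)) Xs) (map (\<lambda>X. X (fst k) (snd k)) Ys))"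
  shows "umean g \<le> \<Delta> (map (\<lambda>k. pdist (ss ! k) (Xs ! k) (Ys ! k)) [0..<length ss])"
proof -
  let ?s = "\<lambda>k. slice (ss ! k) (Xs ! k) (Ys ! k)"
  have fam: "Xs ! k \<in> families (ss ! k)" "Ys ! k \<in> families (ss ! k)" if "k < length ss" for k
    using X that by (auto simp: ftuples_def)
  have len: "length Xs = length ss" "length Ys = length ss" using X by (auto simp: ftuples_def)
  have eq: "tuple_dists M ss (map (\<lambda>X. X (fst i) (snd i)) Xs) (map (\<lambda>X. X (fst i) (snd i)) Ys)
      = map (\<lambda>k. ?s k i) [0..<length ss]" for i
    using len by (subst tuple_dists_nth) (auto simp: slice_def)
  have s: "bfun (?s k)" "0 \<le> ?s k i" if "k < length ss" for k i
    using fam[OF that] by (auto intro: bfun_slice simp: slice_def)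
  have "umean g \<le> umean (\<lambda>i. \<Delta> (map (\<lambda>k. ?s k i) [0..<length ss]))"
    using g(2) by (intro mono g(1) jensen(1)[OF \<Delta>] s) (simp_all add: eq)
  also have "\<dots> \<le> \<Delta> (map (\<lambda>k. umean (?s k)) [0..<length ss])"
    by (rule jensen(2)[OF \<Delta> s])
  also have "map (\<lambda>k. umean (?s k)) [0..<length ss] = map (\<lambda>k. pdist (ss ! k) (Xs ! k) (Ys ! k)) [0..<length ss]"
    using fam by (simp add: pdist_eq)
  finally show ?thesis .
qed

lemma fmodulus_concave: "f \<in> funs L \<Longrightarrow> concave_modulus (length (fdom L f)) (fmodulus L f)"
  and pmodulus_concave: "p \<in> preds L \<Longrightarrow> concave_modulus (length (pdom L p)) (pmodulus L p)"
  using lang unfolding language_def by blast+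

lemma fpower_pdist:
  assumes f: "f \<in> funs L" and X: "Xs \<in> ftuples (fdom L f)" "Ys \<in> ftuples (fdom L f)"
  shows "pdist (fcod L f) (fpower f Xs) (fpower f Ys)
    \<le> fmodulus L f (map (\<lambda>k. pdist (fdom L f ! k) (Xs ! k) (Ys ! k)) [0..<length (fdom L f)])"
proof -
  note fam = fpower_families[OF f X(1)] fpower_families[OF f X(2)]
  show ?thesis
    unfolding pdist_eq[OF fam]
  proof (rule modulus_umean[OF fmodulus_concave[OF f] X bfun_slice[OF fam]])
    fix k
    show "slice (fcod L f) (fpower f Xs) (fpower f Ys) k \<le> fmodulus L f (tuple_dists M (fdom L f)
        (map (\<lambda>X. X (fst k) (snd k)) Xs) (map (\<lambda>X. X (fst k) (snd k)) Ys))"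
      using str f ftuples_tuples[OF X(1)] ftuples_tuples[OF X(2)]
      unfolding slice_def fpower_def is_structure_def by blast
  qed
qed

lemma ppower_diff:
  assumes p: "p \<in> preds L" and X: "Xs \<in> ftuples (pdom L p)" "Ys \<in> ftuples (pdom L p)"
  shows "\<bar>umean (ppower p Xs) - umean (ppower p Ys)\<bar>
    \<le> pmodulus L p (map (\<lambda>k. pdist (pdom L p ! k) (Xs ! k) (Ys ! k)) [0..<length (pdom L p)])"
proof -
  let ?g = "\<lambda>k. ppower p Xs k - ppower p Ys k"
  have b: "bfun ?g" by (intro bfun_diff bfun_ppower p X)
  have "\<bar>umean (ppower p Xs) - umean (ppower p Ys)\<bar> = \<bar>umean ?g\<bar>"
    by (simp add: diff bfun_ppower p X)
  also have "\<dots> \<le> umean (\<lambda>k. \<bar>?g k\<bar>)" by (rule abs_le[OF b])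
  also have "\<dots> \<le> pmodulus L p (map (\<lambda>k. pdist (pdom L p ! k) (Xs ! k) (Ys ! k)) [0..<length (pdom L p)])"
  proof (rule modulus_umean[OF pmodulus_concave[OF p] X bfun_abs[OF b]])
    fix k
    show "\<bar>?g k\<bar> \<le> pmodulus L p (tuple_dists M (pdom L p)
        (map (\<lambda>X. X (fst k) (snd k)) Xs) (map (\<lambda>X. X (fst k) (snd k)) Ys))"
      using str p ftuples_tuples[OF X(1)] ftuples_tuples[OF X(2)]
      unfolding ppower_def is_structure_def by blast
  qed
  finally show ?thesis .
qed

lemma fpower_cong:
  assumes f: "f \<in> funs L" and X: "Xs \<in> ftuples (fdom L f)" "Ys \<in> ftuples (fdom L f)"
    and "\<And>k. k < length (fdom L f) \<Longrightarrow> pdist (fdom L f ! k) (Xs ! k) (Ys ! k) = 0"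
  shows "pdist (fcod L f) (fpower f Xs) (fpower f Ys) = 0"
proof -
  have "map (\<lambda>k. pdist (fdom L f ! k) (Xs ! k) (Ys ! k)) [0..<length (fdom L f)]
      = map (\<lambda>k. 0) [0..<length (fdom L f)]" using assms(4) by simp
  then show ?thesis
    using fpower_pdist[OF f X] concave_modulus_zero[OF fmodulus_concave[OF f]] pdist_nonneg
    by (metis order_antisym)
qed

lemma ppower_cong:
  assumes p: "p \<in> preds L" and X: "Xs \<in> ftuples (pdom L p)" "Ys \<in> ftuples (pdom L p)"
    and "\<And>k. k < length (pdom L p) \<Longrightarrow> pdist (pdom L p ! k) (Xs ! k) (Ys ! k) = 0"
  shows "umean (ppower p Xs) = umean (ppower p Ys)"
proof -
  have "map (\<lambda>k. pdist (pdom L p ! k) (Xs ! k) (Ys ! k)) [0..<length (pdom L p)]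
      = map (\<lambda>k. 0) [0..<length (pdom L p)]" using assms(4) by simp
  then have "\<bar>umean (ppower p Xs) - umean (ppower p Ys)\<bar> \<le> 0"
    using ppower_diff[OF p X] concave_modulus_zero[OF pmodulus_concave[OF p]] by metis
  then show ?thesis by simp
qed

subsection \<open>Completeness\<close>

lemma power_metric: "Metric_space (carrier power s) (mdist power s)"
proof
  fix X Y Z
  show "0 \<le> mdist power s X Y" by (simp add: pdist_nonneg)
  show "mdist power s X Y = mdist power s Y X" by (simp add: pdist_commute)
  assume "X \<in> carrier power s" "Y \<in> carrier power s"
  then obtain X' Y' where *: "X' \<in> families s" "X = rep s X'" "Y' \<in> families s" "Y = rep s Y'" by auto
  show "mdist power s X Y = 0 \<longleftrightarrow> X = Y"
  proof
    assume "mdist power s X Y = 0"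
    moreover have "pdist s X' Y' = pdist s X Y"
      unfolding * by (intro pdist_cong rep *)
    ultimately show "X = Y" using * by (auto intro: rep_eq)
  qed (simp add: pdist_self)
  assume "Z \<in> carrier power s"
  then show "mdist power s X Z \<le> mdist power s X Y + mdist power s Y Z"
    using * by (auto intro!: pdist_triangle rep)
qed

lemma pdist_le:
  assumes "X \<in> families s" "Y \<in> families s"
    and "eventually (\<lambda>n. \<Lambda> (\<lambda>i. mdist M s (X n i) (Y n i)) \<le> c) F"
  shows "pdist s X Y \<le> c"
  using umean_le[OF bfun_slice[OF assms(1,2)], of c] assms by (simp add: pdist_eq slice_def)

lemma pdist_less:
  assumes "X \<in> families s" "Y \<in> families s" "pdist s X Y < c"
  shows "eventually (\<lambda>n. \<Lambda> (\<lambda>i. mdist M s (X n i) (Y n i)) < c) F"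
  using umean_less[OF bfun_slice[OF assms(1,2)], of c] assms by (simp add: pdist_eq slice_def)

text \<open>For \<open>F\<close>-almost all \<open>n\<close> the inequalities between the terms up to index \<open>k\<close> hold in the slice at
  \<open>n\<close>. In that slice the limit \<open>W\<close> copies the term \<open>Z (\<kappa> n)\<close>, where \<open>\<kappa> n\<close> is the largest
  \<open>k \<le> n\<close> for which this is the case. As \<open>F\<close> is nonprincipal, \<open>j \<le> \<kappa> n\<close> holds for each \<open>j\<close> and
  \<open>F\<close>-almost all \<open>n\<close>.\<close>

lemma diagonal_limit:
  assumes Z: "\<And>j. Z j \<in> families s"
    and close: "\<And>j m. j \<le> m \<Longrightarrow> pdist s (Z j) (Z m) < (1/2) ^ j"
  obtains W where "W \<in> families s" "\<And>j. pdist s (Z j) W \<le> (1/2) ^ j"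
proof -
  let ?d = "\<lambda>n X Y. \<Lambda> (\<lambda>i. mdist M s (X n i) (Y n i))"
  define P where "P k n \<longleftrightarrow> (\<forall>m\<in>{..k}. \<forall>j\<in>{..m}. ?d n (Z j) (Z m) < (1/2) ^ j)" for k n
  have P_ev: "eventually (P k) F" for k
    unfolding P_def[abs_def]
    by (intro eventually_ball_finite ballI pdist_less Z close) auto
  have P0: "P 0 n" for n
  proof -
    have "mdist M s (Z 0 n i) (Z 0 n i) = 0" for i
      using Metric_space.zero[OF metric] familiesD[OF Z] by blast
    then show ?thesis by (simp add: P_def)
  qed
  define \<kappa> where "\<kappa> n = Max {k. k \<le> n \<and> P k n}" for n
  have fin: "finite {k. k \<le> n \<and> P k n}" for n by (rule finite_subset[of _ "{..n}"]) auto
  have "\<kappa> n \<in> {k. k \<le> n \<and> P k n}" for n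
    unfolding \<kappa>_def using P0[of n] fin by (intro Max_in) auto
  then have \<kappa>: "P (\<kappa> n) n" for n by blast
  define W where "W n = Z (\<kappa> n) n" for n
  have W: "W \<in> families s" unfolding W_def[abs_def] by (intro familiesI familiesD[OF Z])
  have "pdist s (Z j) W \<le> (1/2) ^ j" for j
  proof (rule pdist_le[OF Z W])
    have "eventually (\<lambda>n. j \<le> n) F" using eventually_ge_at_top le_sequentially by (rule filter_leD[rotated])
    with P_ev[of j] show "eventually (\<lambda>n. ?d n (Z j) W \<le> (1/2) ^ j) F"
    proof eventually_elim
      case (elim n)
      then have "j \<le> \<kappa> n" unfolding \<kappa>_def using fin by (intro Max_ge) auto
      then show ?case using \<kappa>[of n] unfolding P_def W_def by (auto intro: less_imp_le)
    qed
  qed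
  with W show thesis by (rule that)
qed

lemma power_complete: "Metric_space.mcomplete (carrier power s) (mdist power s)"
proof -
  interpret N: Metric_space "carrier power s" "mdist power s" by (rule power_metric)
  show ?thesis
    unfolding N.mcomplete_def
  proof (intro allI impI)
    fix \<sigma> assume \<sigma>: "N.MCauchy \<sigma>"
    have fam: "\<sigma> n \<in> families s" for n
      using \<sigma> carrier_power_families unfolding N.MCauchy_def by blast
    have "\<exists>K. \<forall>n n'. K \<le> n \<longrightarrow> K \<le> n' \<longrightarrow> pdist s (\<sigma> n) (\<sigma> n') < (1/2) ^ j" for j
      using \<sigma> unfolding N.MCauchy_def by simp
    then obtain K where K: "\<And>j n n'. K j \<le> n \<Longrightarrow> K j \<le> n' \<Longrightarrow> pdist s (\<sigma> n) (\<sigma> n') < (1/2) ^ j"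
      by metis
    \<comment> \<open>Partial sums dominate all the earlier \<open>K i\<close>, so the terms \<open>\<sigma> (r j)\<close> converge rapidly.\<close>
    define r where "r j = (\<Sum>i\<le>j. K i)" for j
    have r: "K j \<le> r m" if "j \<le> m" for j m
      unfolding r_def using that by (intro member_le_sum) auto
    obtain W where W: "W \<in> families s" "\<And>j. pdist s (\<sigma> (r j)) W \<le> (1/2) ^ j"
      by (rule diagonal_limit[of "\<lambda>j. \<sigma> (r j)" s]) (use fam K r in auto)
    have lim: "eventually (\<lambda>n. \<sigma> n \<in> carrier power s \<and> mdist power s (\<sigma> n) (rep s W) < e) sequentially"
      if "0 < e" for e
    proof -
      obtain j where j: "(1/2 :: real) ^ j < e / 2"
        using real_arch_pow_inv[of "e / 2" "1/2"] \<open>0 < e\<close> by auto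
      have "pdist s (\<sigma> n) (rep s W) < e" if "K j \<le> n" for n
      proof -
        have "pdist s (\<sigma> n) (rep s W) = pdist s (\<sigma> n) W"
          using rep[OF W(1)] fam W(1) by (intro pdist_cong) (auto simp: pdist_self pdist_commute)
        also have "\<dots> \<le> pdist s (\<sigma> n) (\<sigma> (r j)) + pdist s (\<sigma> (r j)) W"
          by (intro pdist_triangle fam W)
        also have "\<dots> < e" using K[OF that r[OF order_refl]] W(2)[of j] j by linarith
        finally show ?thesis .
      qed
      moreover have "\<sigma> n \<in> carrier power s" for n using \<sigma> unfolding N.MCauchy_def by blast
      ultimately show ?thesis
        unfolding eventually_sequentially power_sel(2) by (intro exI[of _ "K j"]) blast
    qed
    show "\<exists>X. limitin N.mtopology \<sigma> X sequentially"
      unfolding N.limitin_metric using lim W(1) by (intro exI[of _ "rep s W"]) auto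
  qed
qed

theorem power_structure: "is_structure L power"
  unfolding is_structure_def
proof (intro conjI allI ballI)
  fix s
  obtain m where "m \<in> carrier M s" using carrier_nonempty[OF str] by blast
  then have "(\<lambda>n i. m) \<in> families s" by (rule familiesI)
  then show "carrier power s \<noteq> {}" by auto
  show "Metric_space (carrier power s) (mdist power s)" by (rule power_metric)
  show "Metric_space.mcomplete (carrier power s) (mdist power s)" by (rule power_complete)
  fix X Y assume "X \<in> carrier power s" "Y \<in> carrier power s"
  then have fam: "X \<in> families s" "Y \<in> families s" by (auto dest: carrier_power_families simp del: power_sel)
  have "slice s X Y k \<le> diam_bound L s" for k
    using str fam[THEN familiesD] unfolding is_structure_def slice_def by blast
  then show "mdist power s X Y \<le> diam_bound L s"
    using fam by (simp add: pdist_eq le_const bfun_slice)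
next
  fix f Xs assume f: "f \<in> funs L" and "Xs \<in> tuples power (fdom L f)"
  then have X: "Xs \<in> ftuples (fdom L f)" by (rule_tac tuples_power)
  show "fint power f Xs \<in> carrier power (fcod L f)"
    using fpower_families[OF f X] by simp
  fix Ys assume "Ys \<in> tuples power (fdom L f)"
  then have Y: "Ys \<in> ftuples (fdom L f)" by (rule tuples_power)
  have "pdist (fcod L f) (fpower f Xs) (fpower f Ys)
      = pdist (fcod L f) (rep (fcod L f) (fpower f Xs)) (rep (fcod L f) (fpower f Ys))"
    by (intro pdist_cong rep fpower_families f X Y)
  then show "mdist power (fcod L f) (fint power f Xs) (fint power f Ys)
      \<le> fmodulus L f (tuple_dists power (fdom L f) Xs Ys)"
    using fpower_pdist[OF f X Y] X Y by (simp add: tuple_dists_nth ftuples_def)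
next
  fix p Xs assume p: "p \<in> preds L" and "Xs \<in> tuples power (pdom L p)"
  then have X: "Xs \<in> ftuples (pdom L p)" by (rule_tac tuples_power)
  have "ppower p Xs k \<in> {plower L p..pupper L p}" for k
    using str p ftuples_tuples[OF X] unfolding is_structure_def ppower_def by blast
  then show "pint power p Xs \<in> {plower L p..pupper L p}"
    by (auto intro!: le_const ge_const bfun_ppower p X)
  fix Ys assume "Ys \<in> tuples power (pdom L p)"
  then have Y: "Ys \<in> ftuples (pdom L p)" by (rule tuples_power)
  show "\<bar>pint power p Xs - pint power p Ys\<bar> \<le> pmodulus L p (tuple_dists power (pdom L p) Xs Ys)"
    using ppower_diff[OF p X Y] X Y by (simp add: tuple_dists_nth ftuples_def)
qed

subsection \<open>Values of formulas in the power\<close>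

text \<open>The values \<open>V\<close> are chosen representatives, while \<open>W\<close> is any family in the same class. Separating
  the two permits to compute with pointwise families, which interpretations of function symbols do not
  preserve literally.\<close>

definition represents :: "('s var \<Rightarrow> nat \<Rightarrow> 'i \<Rightarrow> 'a) \<Rightarrow> ('s var \<Rightarrow> nat \<Rightarrow> 'i \<Rightarrow> 'a) \<Rightarrow> bool" where
  "represents V W \<longleftrightarrow> assigns power V \<and> (\<forall>x. W x \<in> families (fst x) \<and> pdist (fst x) (V x) (W x) = 0)"

lemma representsI:
  "assigns power V \<Longrightarrow> (\<And>x. W x \<in> families (fst x)) \<Longrightarrow> (\<And>x. pdist (fst x) (V x) (W x) = 0) \<Longrightarrow> represents V W"
  unfolding represents_def by blast

lemma represents_rep: "(\<And>x. W x \<in> families (fst x)) \<Longrightarrow> represents (\<lambda>x. rep (fst x) (W x)) W"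
  by (rule representsI) (auto simp: assigns_def pdist_commute rep simp del: split_paired_All)

lemma represents_upd:
  assumes "represents V W" "C \<in> families (fst x)"
  shows "represents (V(x := rep (fst x) C)) (W(x := C))"
  using assms rep[OF assms(2)] unfolding represents_def
  by (auto intro!: assigns_upd simp: pdist_commute simp del: split_paired_All)

lemma represents_upd_self:
  assumes "represents V W" "C \<in> carrier power (fst x)"
  shows "represents (V(x := C)) (W(x := C))"
  using assms carrier_power_families[OF assms(2)] unfolding represents_def
  by (auto intro!: assigns_upd simp: pdist_self simp del: split_paired_All)

lemma represents_assigns: "represents V W \<Longrightarrow> assigns M (\<lambda>x. W x n i)"
  unfolding represents_def assigns_def using familiesD[of "W x" "fst x" n i for x] by blast

lemma power_tm_val:
  assumes VW: "represents V W"
  shows "wf_tm L t \<Longrightarrow> pdist (tm_sort L t) (tm_val power V t) (\<lambda>n i. tm_val M (\<lambda>x. W x n i) t) = 0"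
proof (induction t)
  case (Var x)
  then show ?case using VW by (simp add: represents_def del: split_paired_All)
next
  case (App f ts)
  have f: "f \<in> funs L" and ts: "map (tm_sort L) ts = fdom L f" "\<forall>t\<in>set ts. wf_tm L t"
    using App.prems by auto
  have len: "length ts = length (fdom L f)" using ts(1) by (metis length_map)
  have srt: "fdom L f ! k = tm_sort L (ts ! k)" if "k < length (fdom L f)" for k
    using arg_cong[OF ts(1), of "\<lambda>l. l ! k"] that len by simp
  let ?X = "map (tm_val power V) ts" and ?Y = "map (\<lambda>t n i. tm_val M (\<lambda>x. W x n i) t) ts"
  have V: "assigns power V" using VW by (simp add: represents_def)
  have X: "?X \<in> ftuples (fdom L f)"
    by (rule tuples_power[OF tm_vals_tuples[OF power_structure V ts]])
  have Y: "?Y \<in> ftuples (fdom L f)"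
    using len srt ts(2) represents_assigns[OF VW]
    by (auto simp: ftuples_def intro!: familiesI tm_val_carrier[OF str])
  have 0: "pdist (fcod L f) (fpower f ?X) (fpower f ?Y) = 0"
    using len srt ts(2) by (intro fpower_cong f X Y) (simp add: App.IH)
  have "pdist (fcod L f) (rep (fcod L f) (fpower f ?X)) (fpower f ?Y)
      = pdist (fcod L f) (fpower f ?X) (fpower f ?Y)"
    using fpower_families[OF f X] fpower_families[OF f Y] rep[of "fpower f ?X" "fcod L f"]
    by (intro pdist_cong) (auto simp: pdist_self pdist_commute)
  moreover have "fpower f ?Y = (\<lambda>n i. tm_val M (\<lambda>x. W x n i) (App f ts))"
    by (simp add: fpower_def[abs_def] comp_def)
  ultimately show ?case using 0 by simp
qed

lemma bfun_val:
  assumes "represents V W" "affine_formula L \<phi>"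
  shows "bfun (\<lambda>k. val M (\<lambda>x. W x (fst k) (snd k)) \<phi>)"
  using val_bounded[OF str assms(2)] represents_assigns[OF assms(1)] unfolding bfun_def by blast

text \<open>The supremum of the means is the mean of the suprema, since nearly optimal witnesses, chosen
  at each index separately, form a family.\<close>

lemma power_val_QSup:
  assumes VW: "represents V W" and \<phi>: "affine_formula L \<phi>"
    and IH: "\<And>V W. represents V W \<Longrightarrow> val power V \<phi> = umean (\<lambda>k. val M (\<lambda>x. W x (fst k) (snd k)) \<phi>)"
  shows "val power V (QSup x \<phi>) = umean (\<lambda>k. val M (\<lambda>x. W x (fst k) (snd k)) (QSup x \<phi>))"
proof (rule antisym)
  let ?w = "\<lambda>k x. W x (fst k) (snd k)"
  have upd: "(\<lambda>y. (W(x := C)) y (fst k) (snd k)) = (?w k)(x := C (fst k) (snd k))" for C k by auto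
  have bQ: "bfun (\<lambda>k. val M (?w k) (QSup x \<phi>))" using \<phi> by (intro bfun_val[OF VW]) simp
  have bC: "bfun (\<lambda>k. val M ((?w k)(x := C (fst k) (snd k))) \<phi>)" if "represents V' (W(x := C))" for C V'
    using bfun_val[OF that \<phi>] unfolding upd .
  have bdd: "bdd_above ((\<lambda>c. val M ((?w k)(x := c)) \<phi>) ` carrier M (fst x))" for k
    using \<phi> represents_assigns[OF VW] by (intro val_bdd_above[OF str])
  have "val power (V(x := C)) \<phi> \<le> umean (\<lambda>k. val M (?w k) (QSup x \<phi>))"
    if C: "C \<in> carrier power (fst x)" for C
  proof -
    have r: "represents (V(x := C)) (W(x := C))" by (rule represents_upd_self[OF VW C])
    have fam: "C \<in> families (fst x)" using C by (rule carrier_power_families)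
    show ?thesis
      unfolding IH[OF r] upd using bdd familiesD[OF fam]
      by (intro mono bQ bC[OF r]) (auto intro!: cSUP_upper)
  qed
  then show "val power V (QSup x \<phi>) \<le> umean (\<lambda>k. val M (?w k) (QSup x \<phi>))"
    using carrier_nonempty[OF power_structure] by (simp del: power_sel) (rule cSUP_least)
  show "umean (\<lambda>k. val M (?w k) (QSup x \<phi>)) \<le> val power V (QSup x \<phi>)"
  proof (rule field_le_epsilon)
    fix e :: real assume "0 < e"
    have "\<exists>c\<in>carrier M (fst x). val M (?w k) (QSup x \<phi>) - e < val M ((?w k)(x := c)) \<phi>" for k
    proof -
      have "val M (?w k) (QSup x \<phi>) - e < (SUP c\<in>carrier M (fst x). val M ((?w k)(x := c)) \<phi>)"
        using \<open>0 < e\<close> by simp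
      then show ?thesis using less_cSUP_iff[OF carrier_nonempty[OF str] bdd] by blast
    qed
    then obtain c where c: "\<And>k. c k \<in> carrier M (fst x)"
        "\<And>k. val M (?w k) (QSup x \<phi>) - e < val M ((?w k)(x := c k)) \<phi>" by metis
    define C where "C n i = c (n, i)" for n i
    have C: "C \<in> families (fst x)" unfolding C_def[abs_def] by (intro familiesI c)
    have r: "represents (V(x := rep (fst x) C)) (W(x := C))" by (rule represents_upd[OF VW C])
    have "umean (\<lambda>k. val M (?w k) (QSup x \<phi>)) \<le> umean (\<lambda>k. val M ((?w k)(x := C (fst k) (snd k))) \<phi> + e)"
    proof (intro mono bQ bfun_add bC[OF r] bfun_const)
      show "val M (?w k) (QSup x \<phi>) \<le> val M ((?w k)(x := C (fst k) (snd k))) \<phi> + e" for k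
        using c(2)[of k] by (simp add: C_def)
    qed
    also have "\<dots> = val power (V(x := rep (fst x) C)) \<phi> + e"
      unfolding IH[OF r] upd by (simp add: add bC[OF r])
    also have "val power (V(x := rep (fst x) C)) \<phi> \<le> val power V (QSup x \<phi>)"
    proof -
      have "bdd_above ((\<lambda>c. val power (V(x := c)) \<phi>) ` carrier power (fst x))"
        using VW \<phi> by (intro val_bdd_above[OF power_structure]) (auto simp: represents_def)
      moreover have "rep (fst x) C \<in> carrier power (fst x)" using C by simp
      ultimately show ?thesis unfolding val.simps by (rule cSUP_upper[rotated])
    qed
    finally show "umean (\<lambda>k. val M (?w k) (QSup x \<phi>)) \<le> val power V (QSup x \<phi>) + e" by simp
  qed
qed

text \<open>Los's theorem: affine connectives commute with means, and so do the quantifiers.\<close>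

theorem power_val:
  assumes "affine_formula L \<phi>" "represents V W"
  shows "val power V \<phi> = umean (\<lambda>k. val M (\<lambda>x. W x (fst k) (snd k)) \<phi>)"
  using assms
proof (induction \<phi> arbitrary: V W)
  case (Dist s t u)
  then have tu: "wf_tm L t" "wf_tm L u" "tm_sort L t = s" "tm_sort L u = s" by auto
  have V: "assigns power V" using Dist by (simp add: represents_def)
  have fam: "tm_val power V t' \<in> families (tm_sort L t')" if "wf_tm L t'" for t'
    using tm_val_carrier[OF power_structure V that] by (rule carrier_power_families)
  have fam': "(\<lambda>n i. tm_val M (\<lambda>x. W x n i) t') \<in> families (tm_sort L t')" if "wf_tm L t'" for t'
    using that represents_assigns[OF Dist.prems(2)] by (intro familiesI tm_val_carrier[OF str])
  have "pdist s (tm_val power V t) (tm_val power V u)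
      = pdist s (\<lambda>n i. tm_val M (\<lambda>x. W x n i) t) (\<lambda>n i. tm_val M (\<lambda>x. W x n i) u)"
    using fam[OF tu(1)] fam[OF tu(2)] fam'[OF tu(1)] fam'[OF tu(2)]
      power_tm_val[OF Dist.prems(2) tu(1)] power_tm_val[OF Dist.prems(2) tu(2)]
    unfolding tu by (intro pdist_cong)
  also have "\<dots> = umean (\<lambda>k. val M (\<lambda>x. W x (fst k) (snd k)) (Dist s t u))"
    using fam'[OF tu(1)] fam'[OF tu(2)] unfolding tu by (simp add: pdist_eq slice_def[abs_def])
  finally show ?case by simp
next
  case (Pred p ts)
  have p: "p \<in> preds L" and ts: "map (tm_sort L) ts = pdom L p" "\<forall>t\<in>set ts. wf_tm L t"
    using Pred.prems by auto
  have len: "length ts = length (pdom L p)" using ts(1) by (metis length_map)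
  have srt: "pdom L p ! k = tm_sort L (ts ! k)" if "k < length (pdom L p)" for k
    using arg_cong[OF ts(1), of "\<lambda>l. l ! k"] that len by simp
  let ?X = "map (tm_val power V) ts" and ?Y = "map (\<lambda>t n i. tm_val M (\<lambda>x. W x n i) t) ts"
  have V: "assigns power V" using Pred by (simp add: represents_def)
  have X: "?X \<in> ftuples (pdom L p)"
    by (rule tuples_power[OF tm_vals_tuples[OF power_structure V ts]])
  have Y: "?Y \<in> ftuples (pdom L p)"
    using len srt ts(2) represents_assigns[OF Pred.prems(2)]
    by (auto simp: ftuples_def intro!: familiesI tm_val_carrier[OF str])
  have "umean (ppower p ?X) = umean (ppower p ?Y)"
    using len srt ts(2) by (intro ppower_cong p X Y) (simp add: power_tm_val[OF Pred.prems(2)])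
  then show ?case by (simp add: ppower_def[abs_def] comp_def)
next
  case (Const r)
  then show ?case by simp
next
  case (Add \<phi> \<psi>)
  then show ?case using bfun_val[OF Add.prems(2)] by (simp add: add)
next
  case (Scale r \<phi>)
  then show ?case using bfun_val[OF Scale.prems(2)] by (simp add: scale)
next
  case (QSup x \<phi>)
  then show ?case by (intro power_val_QSup) auto
next
  case (QInf x \<phi>)
  have \<phi>: "affine_formula L \<phi>" using QInf.prems by simp
  have "val power V (Scale (- 1) \<phi>) = umean (\<lambda>k. val M (\<lambda>x. W x (fst k) (snd k)) (Scale (- 1) \<phi>))"
    if "represents V W" for V W
    using QInf.IH[OF \<phi> that] scale[OF bfun_val[OF that \<phi>], of "- 1"] by simp
  then have "val power V (QSup x (Scale (- 1) \<phi>)) = umean (\<lambda>k. val M (\<lambda>x. W x (fst k) (snd k)) (QSup x (Scale (- 1) \<phi>)))"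
    using \<phi> by (intro power_val_QSup[OF QInf.prems(2)]) simp_all
  then show ?case
    unfolding val_QInf using scale[OF bfun_val[OF QInf.prems(2), of "QSup x (Scale (- 1) \<phi>)"], of "- 1"] \<phi>
    by simp
qed

subsection \<open>The diagonal embedding\<close>

definition diagonal :: "'s \<Rightarrow> 'a \<Rightarrow> nat \<Rightarrow> 'i \<Rightarrow> 'a" where
  "diagonal s m = rep s (\<lambda>n i. m)"

lemma const_family: "m \<in> carrier M s \<Longrightarrow> (\<lambda>n i. m) \<in> families s"
  by (rule familiesI)

lemma diagonal_isometry:
  assumes "x \<in> carrier M s" "y \<in> carrier M s"
  shows "pdist s (diagonal s x) (diagonal s y) = mdist M s x y"
proof -
  note c = assms[THEN const_family]
  have "pdist s (\<lambda>n i. x) (\<lambda>n i. y) = pdist s (diagonal s x) (diagonal s y)"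
    unfolding diagonal_def using c by (intro pdist_cong rep)
  then show ?thesis using c by (simp add: pdist_eq slice_def[abs_def])
qed

lemma diagonal_tuple:
  assumes "xs \<in> tuples M ss"
  shows "map2 diagonal ss xs \<in> ftuples ss" "map (\<lambda>x n i. x) xs \<in> ftuples ss"
    and "k < length ss \<Longrightarrow> pdist (ss ! k) (map2 diagonal ss xs ! k) (map (\<lambda>x n i. x) xs ! k) = 0"
  using tuplesD[OF assms] rep[OF const_family]
  by (auto simp: ftuples_def diagonal_def pdist_commute intro!: const_family)

theorem diagonal_affine_extension: "affine_extension_via L diagonal M power"
  unfolding affine_extension_via_def substructure_via_def
proof (intro conjI allI ballI impI)
  show "is_structure L M" "is_structure L power" by (rule str, rule power_structure)
next
  fix s x assume x: "x \<in> carrier M s"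
  then show "diagonal s x \<in> carrier power s" by (simp add: diagonal_def const_family)
  fix y assume "y \<in> carrier M s"
  then show "mdist power s (diagonal s x) (diagonal s y) = mdist M s x y"
    using x by (simp add: diagonal_isometry)
next
  fix f xs assume f: "f \<in> funs L" and xs: "xs \<in> tuples M (fdom L f)"
  note t = diagonal_tuple[OF xs]
  have "pdist (fcod L f) (fpower f (map2 diagonal (fdom L f) xs)) (fpower f (map (\<lambda>x n i. x) xs)) = 0"
    by (intro fpower_cong f t)
  then have "rep (fcod L f) (fpower f (map2 diagonal (fdom L f) xs)) = rep (fcod L f) (fpower f (map (\<lambda>x n i. x) xs))"
    by (intro rep_eq fpower_families f t)
  then show "fint power f (map2 diagonal (fdom L f) xs) = diagonal (fcod L f) (fint M f xs)"
    by (simp add: diagonal_def fpower_def[abs_def] comp_def)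
next
  fix p xs assume p: "p \<in> preds L" and xs: "xs \<in> tuples M (pdom L p)"
  note t = diagonal_tuple[OF xs]
  have "umean (ppower p (map2 diagonal (pdom L p) xs)) = umean (ppower p (map (\<lambda>x n i. x) xs))"
    by (intro ppower_cong p t)
  then show "pint power p (map2 diagonal (pdom L p) xs) = pint M p xs"
    by (simp add: ppower_def[abs_def] comp_def)
next
  fix \<psi> and v :: "'s var \<Rightarrow> 'a" assume *: "affine_formula L \<psi> \<and> (\<forall>x. v x \<in> carrier M (fst x))"
  then have "represents (\<lambda>x. rep (fst x) (\<lambda>n i. v x)) (\<lambda>x n i. v x)"
    by (intro represents_rep const_family) blast
  from power_val[OF _ this] * show "val power (\<lambda>x. diagonal (fst x) (v x)) \<psi> = val M v \<psi>"
    by (simp add: diagonal_def)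
qed

end

section \<open>The averaged copy of the structure in its power\<close>

text \<open>The power of \<open>M\<close> by an averaging mean on its self-maps. The copy of \<open>M\<close> consists of the classes of
  the families \<open>i \<mapsto> move i s m\<close>, constant in \<open>n\<close>; in other words, an element is sent to its
  image under a random map.\<close>

locale averaged_power = affine_pair L M A J sr a b + power: mean_power F \<Lambda> L M
  for L :: "('s, 'f, 'p) lang" and M :: "('s, 'f, 'p, 'a) struct" and A :: "'s \<Rightarrow> 'a set"
    and J :: "'j set" and sr :: "'j \<Rightarrow> 's" and a b :: "'j \<Rightarrow> 'a"
    and F :: "nat filter" and \<Lambda> :: "(('s \<times> 'a \<Rightarrow> 'a) \<Rightarrow> real) \<Rightarrow> real" +
  assumes mean_move: "affine_formula L \<phi> \<Longrightarrow> of_M \<rho> \<Longrightarrow>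
       \<Lambda> (\<lambda>i. val M (eval_item a i \<circ> \<rho>) \<phi>) = val M (eval_item a snd \<circ> \<rho>) \<phi>"
    and mean_a_b: "affine_formula L \<psi> \<Longrightarrow> itemized \<sigma> \<Longrightarrow>
       \<Lambda> (\<lambda>i. val M (eval_item a i \<circ> \<sigma>) \<psi>) = \<Lambda> (\<lambda>i. val M (eval_item b i \<circ> \<sigma>) \<psi>)"
begin

definition item_elem :: "('j \<Rightarrow> 'a) \<Rightarrow> 's \<Rightarrow> ('s \<times> 'a) + 'j \<Rightarrow> nat \<Rightarrow> ('s \<times> 'a \<Rightarrow> 'a) \<Rightarrow> 'a" where
  "item_elem c s q = power.rep s (\<lambda>n i. eval_item c i q)"

definition moved :: "'s \<Rightarrow> 'a \<Rightarrow> nat \<Rightarrow> ('s \<times> 'a \<Rightarrow> 'a) \<Rightarrow> 'a" where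
  "moved s m = power.rep s (\<lambda>n i. move i s m)"

lemma item_elem_Inl: "item_elem c s (Inl (s, m)) = moved s m"
  by (simp add: item_elem_def moved_def)

lemma item_elem_Inr: "item_elem c s (Inr j) = power.diagonal s (c j)"
  by (simp add: item_elem_def power.diagonal_def)

lemma moved_carrier: "m \<in> carrier M s \<Longrightarrow> moved s m \<in> carrier power.power s"
  unfolding moved_def using power.familiesI[of "\<lambda>n i. move i s m" s] move_carrier by simp

lemma moved_A: "m \<in> A s \<Longrightarrow> moved s m = power.diagonal s m"
  unfolding moved_def power.diagonal_def by (simp add: move_A)

lemma val_item_elem:
  assumes \<psi>: "affine_formula L \<psi>" and \<rho>: "itemized \<rho>" and c: "\<And>j. j \<in> J \<Longrightarrow> c j \<in> carrier M (sr j)"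
  shows "val power.power (\<lambda>x. item_elem c (fst x) (\<rho> x)) \<psi> = \<Lambda> (\<lambda>i. val M (eval_item c i \<circ> \<rho>) \<psi>)"
proof -
  have "power.represents (\<lambda>x. item_elem c (fst x) (\<rho> x)) (\<lambda>x n i. eval_item c i (\<rho> x))"
    unfolding item_elem_def
    by (intro power.represents_rep power.familiesI) (use assignsD[OF assigns_eval[OF \<rho> c]] in simp)
  from power.power_val[OF \<psi> this] show ?thesis
    using power.umean_slice[of "\<lambda>i. val M (eval_item c i \<circ> \<rho>) \<psi>"] by (simp add: comp_def)
qed

text \<open>The first property of the averaging mean: the random copy of a tuple has the affine type of the
  tuple, also with parameters in \<open>A\<close> since these do not move.\<close>

lemma val_moved:
  assumes \<psi>: "affine_formula L \<psi>" and m: "assigns M m"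
  shows "val power.power (\<lambda>x. moved (fst x) (m x)) \<psi> = val power.power (\<lambda>x. power.diagonal (fst x) (m x)) \<psi>"
proof -
  define \<rho> :: "'s var \<Rightarrow> ('s \<times> 'a) + 'j" where "\<rho> x = Inl (fst x, m x)" for x
  have \<rho>: "of_M \<rho>" using assignsD[OF m] by (simp add: of_M_def \<rho>_def del: split_paired_All)
  have "val power.power (\<lambda>x. moved (fst x) (m x)) \<psi> = val M (eval_item a snd \<circ> \<rho>) \<psi>"
    using val_item_elem[OF \<psi> of_M_itemized[OF \<rho>] a] mean_move[OF \<psi> \<rho>]
    by (simp add: \<rho>_def item_elem_Inl)
  also have "eval_item a snd \<circ> \<rho> = m" by (simp add: \<rho>_def fun_eq_iff)
  also have "val M m \<psi> = val power.power (\<lambda>x. power.diagonal (fst x) (m x)) \<psi>"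
    using power.diagonal_affine_extension \<psi> m unfolding affine_extension_via_def assigns_def by simp
  finally show ?thesis .
qed

lemma moved_equiv:
  fixes v w :: "'s var \<Rightarrow> nat \<Rightarrow> ('s \<times> 'a \<Rightarrow> 'a) \<Rightarrow> 'a"
  assumes \<psi>: "affine_formula L \<psi>"
    and vw: "\<And>x. x \<in> free_vars \<psi> \<Longrightarrow>
      \<exists>m\<in>carrier M (fst x). v x = moved (fst x) m \<and> w x = power.diagonal (fst x) m"
  shows "val power.power v \<psi> = val power.power w \<psi>"
proof -
  have "\<forall>x. \<exists>m. m \<in> carrier M (fst x) \<and>
      (x \<in> free_vars \<psi> \<longrightarrow> v x = moved (fst x) m \<and> w x = power.diagonal (fst x) m)"
    using vw carrier_nonempty[OF str] by blast
  then obtain m where m: "\<And>x. m x \<in> carrier M (fst x)"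
    "\<And>x. x \<in> free_vars \<psi> \<Longrightarrow> v x = moved (fst x) (m x) \<and> w x = power.diagonal (fst x) (m x)" by metis
  have "val power.power v \<psi> = val power.power (\<lambda>x. moved (fst x) (m x)) \<psi>"
    by (rule val_cong) (use m in blast)
  also have "\<dots> = val power.power (\<lambda>x. power.diagonal (fst x) (m x)) \<psi>"
    using m by (intro val_moved[OF \<psi>]) (simp add: assigns_def del: split_paired_All)
  also have "\<dots> = val power.power w \<psi>"
    by (rule val_cong) (use m in auto)
  finally show ?thesis .
qed

lemma inj_diagonal: "inj_on (power.diagonal s) (carrier M s)"
proof
  fix x y assume xy: "x \<in> carrier M s" "y \<in> carrier M s" "power.diagonal s x = power.diagonal s y"
  then have "mdist M s x y = 0"
    using power.diagonal_isometry[of x s y] power.pdist_self by simp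
  then show "x = y" using Metric_space.zero[OF power.metric] xy by blast
qed

lemma moved_sets_equiv:
  assumes AB: "\<And>s. A s \<subseteq> B s" and B: "\<And>s. B s \<subseteq> carrier M s"
  shows "aff_equiv_sets L power.power (\<lambda>s. power.diagonal s ` A s)
    (\<lambda>s. moved s ` B s) (\<lambda>s. power.diagonal s ` B s)"
proof -
  define J0 where "J0 = {(s, power.diagonal s m) | s m. m \<in> B s}"
  define e' where "e' j = moved (fst j) (inv_into (carrier M (fst j)) (power.diagonal (fst j)) (snd j))" for j
  have e': "e' (s, power.diagonal s m) = moved s m" if "m \<in> B s" for s m
    using subsetD[OF B that] by (simp add: e'_def inv_into_f_f[OF inj_diagonal])
  have sec: "{j \<in> J0. fst j = s} = (\<lambda>m. (s, power.diagonal s m)) ` B s" for s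
    by (auto simp: J0_def)
  have "enumerates J0 fst e' (\<lambda>s. moved s ` B s)"
    unfolding enumerates_def sec by (auto simp: image_image e' intro!: image_cong)
  moreover have "enumerates J0 fst snd (\<lambda>s. power.diagonal s ` B s)"
    unfolding enumerates_def sec by (simp add: image_image)
  moreover have "aff_equiv L power.power (\<lambda>s. power.diagonal s ` A s) J0 fst e' snd"
    unfolding aff_equiv_def
  proof (intro allI impI, elim conjE)
    fix \<psi> v w
    assume \<psi>: "affine_formula L \<psi>" and vw: "\<forall>x\<in>free_vars \<psi>.
      (v x = w x \<and> v x \<in> power.diagonal (fst x) ` A (fst x)) \<or>
      (\<exists>j\<in>J0. fst j = fst x \<and> v x = e' j \<and> w x = snd j)"
    show "val power.power v \<psi> = val power.power w \<psi>"
    proof (rule moved_equiv[OF \<psi>])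
      fix x assume "x \<in> free_vars \<psi>"
      from bspec[OF vw this] consider m where "m \<in> A (fst x)" "v x = power.diagonal (fst x) m" "w x = v x"
        | j where "j \<in> J0" "fst j = fst x" "v x = e' j" "w x = snd j" by auto
      then show "\<exists>m\<in>carrier M (fst x). v x = moved (fst x) m \<and> w x = power.diagonal (fst x) m"
      proof cases
        case (1 m)
        then show ?thesis using A moved_A by (intro bexI[of _ m]) auto
      next
        case (2 j)
        then obtain m where "m \<in> B (fst x)" "j = (fst x, power.diagonal (fst x) m)"
          by (auto simp: J0_def)
        then show ?thesis using 2 B e' by (intro bexI[of _ m]) auto
      qed
    qed
  qed
  ultimately show ?thesis unfolding aff_equiv_sets_def by blast
qed

text \<open>The second property of the averaging mean: the random copy of \<open>M\<close> does not distinguish \<open>a\<close> from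
  \<open>b\<close>.\<close>

lemma moved_a_b_equiv:
  assumes B: "\<And>s. B s \<subseteq> carrier M s"
  shows "aff_equiv L power.power (\<lambda>s. moved s ` B s) J sr
    (\<lambda>j. power.diagonal (sr j) (a j)) (\<lambda>j. power.diagonal (sr j) (b j))"
  unfolding aff_equiv_def
proof (intro allI impI, elim conjE)
  fix \<psi> v w
  assume \<psi>: "affine_formula L \<psi>" and vw: "\<forall>x\<in>free_vars \<psi>.
      (v x = w x \<and> v x \<in> moved (fst x) ` B (fst x)) \<or>
      (\<exists>j\<in>J. sr j = fst x \<and> v x = power.diagonal (sr j) (a j) \<and> w x = power.diagonal (sr j) (b j))"
  have "\<exists>q. item_of (fst x) q \<and> v x = item_elem a (fst x) q \<and> w x = item_elem b (fst x) q"
    if "x \<in> free_vars \<psi>" for x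
  proof -
    from bspec[OF vw that] consider m where "m \<in> B (fst x)" "v x = moved (fst x) m" "w x = v x"
      | j where "j \<in> J" "sr j = fst x" "v x = power.diagonal (sr j) (a j)" "w x = power.diagonal (sr j) (b j)"
      by auto
    then show ?thesis
    proof cases
      case (1 m)
      then show ?thesis using B by (intro exI[of _ "Inl (fst x, m)"]) (auto simp: item_elem_Inl)
    next
      case (2 j)
      then show ?thesis by (intro exI[of _ "Inr j"]) (auto simp: item_elem_Inr)
    qed
  qed
  moreover have "\<exists>q :: ('s \<times> 'a) + 'j. item_of (fst x) q" for x :: "'s var"
    using exists_of_M unfolding of_M_def by blast
  ultimately have "\<forall>x. \<exists>q. item_of (fst x) q \<and>
      (x \<in> free_vars \<psi> \<longrightarrow> v x = item_elem a (fst x) q \<and> w x = item_elem b (fst x) q)" by blast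
  then obtain \<rho> where \<rho>: "\<And>x. item_of (fst x) (\<rho> x)"
    "\<And>x. x \<in> free_vars \<psi> \<Longrightarrow> v x = item_elem a (fst x) (\<rho> x) \<and> w x = item_elem b (fst x) (\<rho> x)" by metis
  have it: "itemized \<rho>" using \<rho>(1) by (simp add: itemized_def del: split_paired_All)
  have "val power.power v \<psi> = val power.power (\<lambda>x. item_elem a (fst x) (\<rho> x)) \<psi>"
    by (rule val_cong) (use \<rho> in blast)
  also have "\<dots> = val power.power (\<lambda>x. item_elem b (fst x) (\<rho> x)) \<psi>"
    using val_item_elem[OF \<psi> it a] val_item_elem[OF \<psi> it b] mean_a_b[OF \<psi> it] by simp
  also have "\<dots> = val power.power w \<psi>"
    by (rule val_cong) (use \<rho> in auto)
  finally show "val power.power v \<psi> = val power.power w \<psi>" .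
qed

end

theorem theorem7p1:
  fixes L :: "('s, 'f, 'p) lang"
    and T :: "('s, 'f, 'p) aform set"
    and M :: "('s, 'f, 'p, 'a) struct"
    and A B :: "'s \<Rightarrow> 'a set"
    and J :: "'j set" and sr :: "'j \<Rightarrow> 's" and a b :: "'j \<Rightarrow> 'a"
  assumes "language L"
    and "affine_theory L T"
    and "complete_theory L T"
    and "models L M T"
    and "\<forall>s. A s \<subseteq> B s"
    and "\<forall>s. B s \<subseteq> carrier M s"
    and "\<forall>j\<in>J. a j \<in> carrier M (sr j)"
    and "\<forall>j\<in>J. b j \<in> carrier M (sr j)"
    and "aff_equiv L M A J sr a b"
  shows "\<exists>(N :: ('s, 'f, 'p, ('s, 'a) large) struct) h B'.
           affine_extension_via L h M N \<and>
           (\<forall>s. B' s \<subseteq> carrier N s) \<and>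
           aff_equiv_sets L N (\<lambda>s. h s ` A s) B' (\<lambda>s. h s ` B s) \<and>
           aff_equiv L N B' J sr (\<lambda>j. h (sr j) (a j)) (\<lambda>j. h (sr j) (b j)) \<and>
           (\<forall>s. h s ` A s \<subseteq> B' s)"
proof -
  have str: "is_structure L M" using \<open>models L M T\<close> unfolding models_def by blast
  have AB: "A s \<subseteq> B s" and B: "B s \<subseteq> carrier M s" for s
    using assms(5,6) by blast+
  interpret affine_pair L M A J sr a b
    by unfold_locales (use str AB B assms(7-9) in blast)+
  obtain \<Lambda> where \<Lambda>: "mean \<Lambda>" and inv: "\<And>\<phi> \<rho>. affine_formula L \<phi> \<Longrightarrow> of_M \<rho> \<Longrightarrow>
       \<Lambda> (\<lambda>i. val M (eval_item a i \<circ> \<rho>) \<phi>) = val M (eval_item a snd \<circ> \<rho>) \<phi>"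
    "\<And>\<psi> \<sigma>. affine_formula L \<psi> \<Longrightarrow> itemized \<sigma> \<Longrightarrow>
       \<Lambda> (\<lambda>i. val M (eval_item a i \<circ> \<sigma>) \<psi>) = \<Lambda> (\<lambda>i. val M (eval_item b i \<circ> \<sigma>) \<psi>)"
    by (rule exists_averaging_mean) blast
  obtain F where "ultra F" using exists_ultra by blast
  interpret ultra F by fact
  interpret mean \<Lambda> by fact
  interpret averaged_power L M A J sr a b F \<Lambda>
    by unfold_locales (use str \<open>language L\<close> inv in blast)+
  show ?thesis
  proof (intro exI conjI allI)
    show "affine_extension_via L power.diagonal M power.power" by (rule power.diagonal_affine_extension)
    show "moved s ` B s \<subseteq> carrier power.power s" for s
      using moved_carrier B by blast
    show "aff_equiv_sets L power.power (\<lambda>s. power.diagonal s ` A s) (\<lambda>s. moved s ` B s)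
        (\<lambda>s. power.diagonal s ` B s)"
      by (rule moved_sets_equiv[OF AB B])
    show "aff_equiv L power.power (\<lambda>s. moved s ` B s) J sr
        (\<lambda>j. power.diagonal (sr j) (a j)) (\<lambda>j. power.diagonal (sr j) (b j))"
      by (rule moved_a_b_equiv[OF B])
    show "power.diagonal s ` A s \<subseteq> moved s ` B s" for s
      using moved_A AB by (auto simp: image_iff) (metis subsetD)
  qed
qed

end
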